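(* Let $C$ be a reduced, irreducible, non-degenerate curve of degree $d\ge 3$ in $\mathbb{P}^3$. Let $k\ge d$ be a positive integer. Let $Z$ be any set of $m\ge dk+1$ points of $C$. Let $L_1,\ldots,L_m$ be the linear forms dual to the points of $Z$. In particular, $L_1,\ldots,L_m$ can be chosen so that no four vanish on a point (i.e. the points of $Z$ are in linear general position). Then $R/(L_1^k,\ldots,L_m^k)$ fails the Weak Lefschetz Property in degree $k-1$.
   Context: $\mathbb{K}$ is an algebraically closed field of characteristic $0$ and $R=\mathbb{K}[x_0,x_1,x_2,x_3]$. Non-degenerate means not contained in a plane. The linear form dual to a point $[p_0:p_1:p_2:p_3]$ is $p_0x_0+p_1x_1+p_2x_2+p_3x_3$ (defined up to scalar). For an artinian graded algebra $R/I$ and a general linear form $L$, $R/I$ satisfies the Weak Lefschetz Property (WLP) in degree $i$ if the multiplication map $\times L:[R/I]_i\to[R/I]_{i+1}$ has maximal rank (is injective or surjective); otherwise it fails the WLP in degree $i$. *)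

theory Defs
  imports
    "HOL-Analysis.Cartesian_Space"
    "HOL-Library.Poly_Mapping"
    "HOL-Library.Numeral_Type"
    "HOL-Library.Extended_Nat"
    "HOL-Computational_Algebra.Polynomial"
begin

text \<open>
  The type \<open>4\<close> has exactly the elements 0, 1, 2, 3, which index the variables
  and the homogeneous coordinates.
\<close>

type_synonym monom4 = "4 \<Rightarrow>\<^sub>0 nat"
type_synonym 'k poly4 = "monom4 \<Rightarrow>\<^sub>0 'k"

definition monom_degree :: "monom4 \<Rightarrow> nat" where
  "monom_degree a = (\<Sum>i\<in>UNIV. Poly_Mapping.lookup a i)"

definition eval4 :: "'k::comm_ring_1 poly4 \<Rightarrow> 'k ^ 4 \<Rightarrow> 'k" where
  "eval4 F v = (\<Sum>a\<in>Poly_Mapping.keys F.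
      Poly_Mapping.lookup F a * (\<Prod>i\<in>UNIV. (v $ i) ^ Poly_Mapping.lookup a i))"

definition var4 :: "4 \<Rightarrow> 'k::comm_ring_1 poly4" where
  "var4 i = Poly_Mapping.single (Poly_Mapping.single i 1) 1"

definition scale4 :: "'k::comm_ring_1 \<Rightarrow> 'k poly4 \<Rightarrow> 'k poly4" where
  "scale4 c F = Poly_Mapping.single 0 c * F"

definition linear_form :: "'k::comm_ring_1 ^ 4 \<Rightarrow> 'k poly4" where
  "linear_form v = (\<Sum>i\<in>UNIV. scale4 (v $ i) (var4 i))"

definition forms :: "nat \<Rightarrow> 'k::comm_ring_1 poly4 set" where
  "forms t = {F. \<forall>a\<in>Poly_Mapping.keys F. monom_degree a = t}"

global_interpretation ideal: module "(*) :: 'a::comm_ring_1 \<Rightarrow> 'a \<Rightarrow> 'a"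
  by standard (simp_all add: algebra_simps)

global_interpretation poly4: vector_space "scale4 :: 'k::field \<Rightarrow> 'k poly4 \<Rightarrow> 'k poly4"
proof
  fix a b :: 'k and x y :: "'k poly4"
  show "scale4 a (x + y) = scale4 a x + scale4 a y"
    unfolding scale4_def by (rule distrib_left)
  show "scale4 (a + b) x = scale4 a x + scale4 b x"
    unfolding scale4_def by (simp only: single_add distrib_right)
  show "scale4 a (scale4 b x) = scale4 (a * b) x"
    unfolding scale4_def by (simp only: mult.assoc [symmetric] mult_single add_0_left)
  show "scale4 1 x = x"
    unfolding scale4_def by simp
qed

text \<open>A point of projective three-space is a line through the origin.\<close>

definition proj_space :: "('k::field ^ 4) set set" where
  "proj_space = {vec.span {v} | v. v \<noteq> 0}"

definition vanishes_at :: "'k::field poly4 \<Rightarrow> ('k ^ 4) set \<Rightarrow> bool" where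
  "vanishes_at F p \<longleftrightarrow> (\<forall>v\<in>p. eval4 F v = 0)"

definition is_dual_form :: "'k::field poly4 \<Rightarrow> ('k ^ 4) set \<Rightarrow> bool" where
  "is_dual_form L p \<longleftrightarrow> (\<exists>v\<in>p. v \<noteq> 0 \<and> L = linear_form v)"

definition zero_locus :: "'k::field poly4 set \<Rightarrow> ('k ^ 4) set set" where
  "zero_locus S = {p\<in>proj_space. \<forall>F\<in>S. vanishes_at F p}"

definition zariski_closed :: "('k::field ^ 4) set set \<Rightarrow> bool" where
  "zariski_closed Y \<longleftrightarrow> (\<exists>S \<subseteq> (\<Union>t. forms t). Y = zero_locus S)"

definition irreducible_closed :: "('k::field ^ 4) set set \<Rightarrow> bool" where
  "irreducible_closed Y \<longleftrightarrow> zariski_closed Y \<and> Y \<noteq> {} \<and>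
     (\<forall>A B. zariski_closed A \<and> zariski_closed B \<and> Y = A \<union> B \<longrightarrow> Y = A \<or> Y = B)"

definition proj_dim :: "('k::field ^ 4) set set \<Rightarrow> enat" where
  "proj_dim Y = Sup {enat n | n. \<exists>W :: nat \<Rightarrow> ('k ^ 4) set set.
     (\<forall>i\<le>n. irreducible_closed (W i) \<and> W i \<subseteq> Y) \<and> (\<forall>i<n. W i \<subset> W (Suc i))}"

text \<open>
  A reduced irreducible curve is identified with its set of points: it carries the
  reduced structure given by its full vanishing ideal.
\<close>

definition irreducible_curve :: "('k::field ^ 4) set set \<Rightarrow> bool" where
  "irreducible_curve C \<longleftrightarrow> irreducible_closed C \<and> proj_dim C = 1"

definition nondegenerate :: "('k::field ^ 4) set set \<Rightarrow> bool" where
  "nondegenerate Y \<longleftrightarrow> \<not> (\<exists>H \<in> forms 1. H \<noteq> 0 \<and> Y \<subseteq> zero_locus {H})"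

definition vanishing_ideal :: "('k::field ^ 4) set set \<Rightarrow> 'k poly4 set" where
  "vanishing_ideal Y = {F. \<forall>p\<in>Y. vanishes_at F p}"

text \<open>
  For a homogeneous ideal \<open>I\<close>, the degree \<open>t\<close> piece of \<open>R/I\<close> is the quotient of the
  finite-dimensional space \<open>forms t\<close> by its subspace \<open>I \<inter> forms t\<close>.
\<close>

definition hilbert_function :: "'k::field poly4 set \<Rightarrow> nat \<Rightarrow> nat" where
  "hilbert_function I t = poly4.dim (forms t :: 'k poly4 set) - poly4.dim (I \<inter> forms t)"

definition is_hilbert_polynomial :: "'k::field poly4 set \<Rightarrow> rat poly \<Rightarrow> bool" where
  "is_hilbert_polynomial I P \<longleftrightarrow>
     (\<forall>\<^sub>F t in sequentially. of_nat (hilbert_function I t) = poly P (of_nat t))"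

text \<open>
  The degree of an \<open>r\<close>-dimensional projective set is \<open>r!\<close> times the leading coefficient
  of its Hilbert polynomial, which has degree \<open>r\<close>.
\<close>

definition has_degree :: "('k::field ^ 4) set set \<Rightarrow> nat \<Rightarrow> bool" where
  "has_degree Y d \<longleftrightarrow> (\<exists>P. is_hilbert_polynomial (vanishing_ideal Y) P \<and>
     enat (degree P) = proj_dim Y \<and> of_nat d = fact (degree P) * lead_coeff P)"

definition residue_class :: "'k::comm_ring_1 poly4 set \<Rightarrow> 'k poly4 \<Rightarrow> 'k poly4 set" where
  "residue_class I F = {G. G - F \<in> I}"

definition quotient_piece :: "'k::comm_ring_1 poly4 set \<Rightarrow> nat \<Rightarrow> 'k poly4 set set" where
  "quotient_piece I t = residue_class I ` forms t"

text \<open>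
  Multiplication by \<open>L\<close> on residue classes; all classes in the union coincide when \<open>I\<close>
  is an ideal.
\<close>

definition quotient_mult :: "'k::comm_ring_1 poly4 set \<Rightarrow> 'k poly4 \<Rightarrow> 'k poly4 set \<Rightarrow> 'k poly4 set" where
  "quotient_mult I L X = (\<Union>F\<in>X. residue_class I (L * F))"

definition mult_max_rank :: "'k::comm_ring_1 poly4 set \<Rightarrow> nat \<Rightarrow> 'k poly4 \<Rightarrow> bool" where
  "mult_max_rank I i L \<longleftrightarrow>
     inj_on (quotient_mult I L) (quotient_piece I i) \<or>
     quotient_mult I L ` quotient_piece I i = quotient_piece I (i + 1)"

text \<open>
  A property holds for a general linear form if it holds on a nonempty Zariski-open set of
  coefficient vectors; such a set contains the nonvanishing locus of a nonzero polynomial.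
\<close>

definition for_general_linear_form :: "('k::field poly4 \<Rightarrow> bool) \<Rightarrow> bool" where
  "for_general_linear_form Q \<longleftrightarrow>
     (\<exists>G :: 'k poly4. G \<noteq> 0 \<and> (\<forall>v. eval4 G v \<noteq> 0 \<longrightarrow> Q (linear_form v)))"

definition WLP_in_degree :: "'k::field poly4 set \<Rightarrow> nat \<Rightarrow> bool" where
  "WLP_in_degree I i \<longleftrightarrow> for_general_linear_form (mult_max_rank I i)"

end

theory Submission
  imports Defs
begin

text \<open>
  Let \<open>I\<close> be the ideal of \<open>C\<close>, \<open>Z\<close> a set of more than \<open>d k\<close> points of \<open>C\<close>, and \<open>P \<noteq> 0\<close>.
  Under the apolarity pairing multiplication by the form dual to \<open>P\<close> is adjoint to the
  derivative \<open>D\<close> in direction \<open>P\<close>, and the forms of degree \<open>k\<close> orthogonal to the powers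
  \<open>L\<^sub>p\<^sup>k\<close> are those vanishing on \<open>Z\<close>, which by Bezout are those in \<open>I\<close>. Hence multiplication
  is surjective iff \<open>D\<close> is injective on \<open>I\<^sub>k\<close>, and injective iff \<open>D\<close> maps \<open>I\<^sub>k\<close> onto all forms
  of degree \<open>k - 1\<close>. Both fail, for every \<open>P\<close>. The kernel of \<open>D\<close> on \<open>I\<^sub>k\<close> consists of the cones
  with vertex \<open>P\<close> containing \<open>C\<close>. In coordinates \<open>x\<^sub>0, x\<^sub>1, x\<^sub>2, y\<close> with only \<open>y\<close> nonzero at \<open>P\<close>
  these are the multiples of one form \<open>F(x\<^sub>0, x\<^sub>1, x\<^sub>2)\<close>, monic in \<open>x\<^sub>2\<close>, and comparing growth with the
  Hilbert function of \<open>C\<close> gives \<open>deg F \<le> d \<le> k\<close>. If \<open>D\<close> were onto, \<open>y x\<^sub>0\<^sup>k\<^sup>-\<^sup>1\<close> and \<open>y x\<^sub>1\<^sup>k\<^sup>-\<^sup>1\<close> would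
  agree on \<open>C\<close> with forms \<open>f, g\<close> in \<open>x\<^sub>0, x\<^sub>1, x\<^sub>2\<close>, which can be reduced modulo \<open>F\<close>; then
  \<open>f x\<^sub>1\<^sup>k\<^sup>-\<^sup>1 = g x\<^sub>0\<^sup>k\<^sup>-\<^sup>1\<close>, so \<open>f = x\<^sub>0\<^sup>k\<^sup>-\<^sup>1 h\<close> with \<open>h\<close> linear, and \<open>C\<close> would lie in the plane
  \<open>y = h\<close>.
\<close>

section \<open>Linear algebra\<close>

context vector_space
begin

text \<open>The functional reads off the coordinate of \<open>x\<close> in a basis that contains
  \<open>x\<close> and extends a basis of \<open>span S\<close>; vectors of \<open>S\<close> have no
  component along \<open>x\<close>.\<close>

lemma separating_functional:
  assumes "x \<notin> span S"
  obtains \<phi> where "\<And>u v. \<phi> (u + v) = \<phi> u + \<phi> v" "\<And>c u. \<phi> (scale c u) = c * \<phi> u"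
    "\<And>s. s \<in> S \<Longrightarrow> \<phi> s = 0" "\<phi> x = 1"
proof -
  obtain B where B: "B \<subseteq> S" "independent B" "S \<subseteq> span B"
    using maximal_independent_subset by blast
  have "x \<notin> span B"
    using assms B span_mono by blast
  then have ind: "independent (insert x B)"
    using B(2) independent_insertI by blast
  obtain B' where B': "insert x B \<subseteq> B'" "independent B'" "UNIV \<subseteq> span B'"
    by (rule maximal_independent_subset_extend[OF subset_UNIV ind])
  let ?\<phi> = "\<lambda>w. representation B' w x"
  show thesis
  proof (rule that[of ?\<phi>])
    show "?\<phi> (u + v) = ?\<phi> u + ?\<phi> v" for u v
      using B' by (subst representation_add) auto
    show "?\<phi> (scale c u) = c * ?\<phi> u" for c u
      using B' by (subst representation_scale) auto
    show "?\<phi> x = 1" using B' by (subst representation_basis) auto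
    fix s assume "s \<in> S"
    then have s: "s \<in> span B" using B by blast
    have "representation B' s = representation B s"
      using B' s by (intro representation_extend) auto
    moreover have "x \<notin> B" using \<open>x \<notin> span B\<close> span_base by blast
    ultimately show "?\<phi> s = 0"
      using representation_ne_zero[of B s x] by auto
  qed
qed

lemma span_image_finite:
  assumes "finite J" "u \<in> span (f ` J)"
  shows "\<exists>c. u = (\<Sum>j\<in>J. scale (c j) (f j))"
  using assms
proof (induction J arbitrary: u rule: finite_induct)
  case empty
  then show ?case by simp
next
  case (insert j J)
  then obtain k where "u - scale k (f j) \<in> span (f ` J)"
    by (auto simp: span_insert)
  with insert.IH obtain c where c: "u - scale k (f j) = (\<Sum>j\<in>J. scale (c j) (f j))" by blast
  have "u = (\<Sum>i\<in>insert j J. scale ((c(j := k)) i) (f i))"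
    using insert.hyps c by (simp add: algebra_simps) (rule sum.cong, auto)
  then show ?case by blast
qed

text \<open>Linear independence of the images in the quotient by \<open>U\<close>, formulated for an
  indexed family so that repeated vectors count as dependent and no quotient space has to be
  formed.\<close>

definition indep_family_mod :: "'b set \<Rightarrow> 'c set \<Rightarrow> ('c \<Rightarrow> 'b) \<Rightarrow> bool" where
  "indep_family_mod U J f \<longleftrightarrow> (\<forall>c. (\<Sum>j\<in>J. scale (c j) (f j)) \<in> U \<longrightarrow> (\<forall>j\<in>J. c j = 0))"

text \<open>The vectors \<open>f j\<close> together with a basis of \<open>U\<close> stay
  independent, so they extend to a basis of \<open>V\<close>.\<close>

lemma indep_family_mod_card_le:
  assumes "finite J" "local.indep_family_mod U J f" "f ` J \<subseteq> V" "subspace U" "U \<subseteq> V"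
    "V \<subseteq> span W" "finite W"
  shows "card J \<le> dim V - dim U"
proof -
  obtain B where B: "B \<subseteq> U" "independent B" "U \<subseteq> span B" "card B = dim U"
    by (rule basis_exists)
  have fin: "finite B"
    using independent_span_bound[of W B] B assms by auto
  have spB: "span B = U"
    using B assms by (rule_tac span_subspace) (auto simp: B)
  have "independent (f ` J' \<union> B) \<and> finite (f ` J' \<union> B) \<and> card (f ` J' \<union> B) = card J' + card B"
    if "finite J'" "J' \<subseteq> J" for J'
    using that
  proof (induction J' rule: finite_induct)
    case empty
    then show ?case using B fin by simp
  next
    case (insert j J')
    have "f j \<notin> span (f ` J' \<union> B)"
    proof
      assume "f j \<in> span (f ` J' \<union> B)"
      then obtain u w where uw: "f j = u + w" "u \<in> span (f ` J')" "w \<in> U"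
        by (auto simp: span_Un spB)
      obtain c where c: "u = (\<Sum>i\<in>J'. scale (c i) (f i))"
        using span_image_finite[OF insert.hyps(1) uw(2)] by blast
      \<comment> \<open>These coefficients turn the expression of \<open>f j\<close> into a
        combination of the family that lies in \<open>U\<close> and has coefficient 1 at
        \<open>j\<close>.\<close>
      define c' where "c' = (\<lambda>i. if i = j then 1 else if i \<in> J' then - c i else 0)"
      have "(\<Sum>i\<in>J. scale (c' i) (f i)) = (\<Sum>i\<in>insert j J'. scale (c' i) (f i))"
        using insert.prems assms(1) by (intro sum.mono_neutral_right) (auto simp: c'_def)
      also have "\<dots> = f j + (\<Sum>i\<in>J'. scale (- c i) (f i))"
        using insert.hyps by (simp add: c'_def) (rule sum.cong, auto)
      also have "\<dots> = w" using uw c by (simp add: sum_negf)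
      finally have "\<forall>i\<in>J. c' i = 0"
        using assms(2) uw(3) by (simp add: local.indep_family_mod_def)
      then have "c' j = 0" using insert.prems by blast
      then show False by (simp add: c'_def)
    qed
    moreover have IH: "independent (f ` J' \<union> B)" "finite (f ` J' \<union> B)"
        "card (f ` J' \<union> B) = card J' + card B"
      using insert.IH insert.prems by auto
    ultimately have "independent (insert (f j) (f ` J' \<union> B))"
      by (intro independent_insertI)
    moreover have "f j \<notin> f ` J' \<union> B"
      using \<open>f j \<notin> span (f ` J' \<union> B)\<close> span_base[of "f j" "f ` J' \<union> B"] by argo
    ultimately show ?case using IH insert.hyps by simp
  qed
  then have C: "independent (f ` J \<union> B)" "card (f ` J \<union> B) = card J + dim U"
    using assms(1) B(4) by auto
  have "f ` J \<union> B \<subseteq> V" using assms B by auto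
  then obtain B' where B': "f ` J \<union> B \<subseteq> B'" "B' \<subseteq> V" "independent B'" "V \<subseteq> span B'"
    by (rule maximal_independent_subset_extend[OF _ C(1)])
  have "card B' = dim V" using B' by (intro basis_card_eq_dim)
  moreover have "finite B'" using independent_span_bound[of W B'] B' assms by auto
  ultimately have "card J + dim U \<le> dim V"
    using C(2) B'(1) by (metis card_mono)
  then show ?thesis by linarith
qed

text \<open>The vectors added when a basis of \<open>U\<close> is extended to one of
  \<open>V\<close> form such a family.\<close>

lemma indep_family_mod_exists:
  assumes "subspace U" "U \<subseteq> V" "V \<subseteq> span W" "finite W"
  obtains f where "local.indep_family_mod U {..<dim V - dim U} f" "f ` {..<dim V - dim U} \<subseteq> V"
proof -
  obtain B where B: "B \<subseteq> U" "independent B" "U \<subseteq> span B" "card B = dim U"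
    by (rule basis_exists)
  have spB: "span B = U"
    using B assms by (rule_tac span_subspace) (auto simp: B)
  obtain B' where B': "B \<subseteq> B'" "B' \<subseteq> V" "independent B'" "V \<subseteq> span B'"
    by (rule maximal_independent_subset_extend[of B V]) (use B assms in auto)
  have fin: "finite B'" using independent_span_bound[of W B'] B' assms by auto
  have "card B' = dim V" using B' by (intro basis_card_eq_dim)
  then have "card (B' - B) = dim V - dim U"
    using B(4) B'(1) fin by (simp add: card_Diff_subset finite_subset)
  then obtain f where f: "bij_betw f {..<dim V - dim U} (B' - B)"
    using fin ex_bij_betw_nat_finite[of "B' - B"] by (auto simp: atLeast0LessThan)
  let ?J = "{..<dim V - dim U}"
  have "local.indep_family_mod U ?J f"
    unfolding local.indep_family_mod_def
  proof (intro allI impI ballI, rule ccontr)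
    fix c j assume c: "(\<Sum>j\<in>?J. scale (c j) (f j)) \<in> U" "j \<in> ?J" "c j \<noteq> 0"
    let ?T = "span (B' - {f j})"
    have fj: "f j \<in> B' - B" using c(2) f by (auto simp: bij_betw_def)
    \<comment> \<open>The combination lies in \<open>U\<close> and its other terms use other basis
      vectors, so \<open>f j\<close> would lie in the span of the rest of \<open>B'\<close>.\<close>
    have "U \<subseteq> ?T" using fj B'(1) unfolding spB[symmetric] by (intro span_mono) auto
    moreover have "(\<Sum>i\<in>?J - {j}. scale (c i) (f i)) \<in> ?T"
    proof (intro span_sum span_scale span_base)
      fix i assume i: "i \<in> ?J - {j}"
      then have "f i \<noteq> f j" using f c(2) by (auto simp: bij_betw_def inj_on_def)
      then show "f i \<in> B' - {f j}" using i f by (auto simp: bij_betw_def)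
    qed
    ultimately have "(\<Sum>j\<in>?J. scale (c j) (f j)) - (\<Sum>i\<in>?J - {j}. scale (c i) (f i)) \<in> ?T"
      using c(1) by (intro span_diff) auto
    moreover have "(\<Sum>j\<in>?J. scale (c j) (f j)) - (\<Sum>i\<in>?J - {j}. scale (c i) (f i)) = scale (c j) (f j)"
      using c(2) by (subst sum.remove[of _ j]) auto
    ultimately have "scale (c j) (f j) \<in> ?T" by simp
    from span_scale[OF this, of "inverse (c j)"] have "f j \<in> ?T" using c(3) by simp
    then show False using B'(3) fj by (auto simp: dependent_def)
  qed
  moreover have "f ` ?J \<subseteq> V" using f B' by (auto simp: bij_betw_def)
  ultimately show thesis by (rule that)
qed

end

section \<open>Evaluation of forms\<close>

text \<open>This rule reassociates products to the left and makes the simplifier loop with the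
  usual associativity rule.\<close>

declare ideal.scale_scale [simp del]

abbreviation monom_val :: "'k::comm_ring_1 ^ 4 \<Rightarrow> monom4 \<Rightarrow> 'k" where
  "monom_val v a \<equiv> \<Prod>i\<in>UNIV. (v $ i) ^ Poly_Mapping.lookup a i"

lemma sum_monomials:
  "F = (\<Sum>a\<in>Poly_Mapping.keys F. Poly_Mapping.single a (Poly_Mapping.lookup F a))"
  by (intro poly_mapping_eqI)
    (auto simp: lookup_sum lookup_single when_def in_keys_iff)

lemma eval4_superset:
  assumes "finite A" "Poly_Mapping.keys F \<subseteq> A"
  shows "eval4 F v = (\<Sum>a\<in>A. Poly_Mapping.lookup F a * monom_val v a)"
  unfolding eval4_def using assms
  by (intro sum.mono_neutral_left) (auto simp: in_keys_iff)

lemma eval4_0 [simp]: "eval4 0 v = 0"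
  by (simp add: eval4_def)

lemma eval4_single [simp]: "eval4 (Poly_Mapping.single a c) v = c * monom_val v a"
  by (simp add: eval4_def)

lemma eval4_1 [simp]: "eval4 1 v = 1"
  unfolding single_one[symmetric] eval4_single by simp

lemma eval4_add [simp]: "eval4 (F + G) v = eval4 F v + eval4 G v"
proof -
  let ?A = "Poly_Mapping.keys F \<union> Poly_Mapping.keys G"
  have "eval4 H v = (\<Sum>a\<in>?A. Poly_Mapping.lookup H a * monom_val v a)"
    if "Poly_Mapping.keys H \<subseteq> ?A" for H
    using that by (intro eval4_superset) auto
  from this[of F] this[of G] this[of "F + G"] show ?thesis
    using keys_add[of F G] by (auto simp: lookup_add algebra_simps sum.distrib)
qed

lemma eval4_sum [simp]: "eval4 (sum f A) v = (\<Sum>x\<in>A. eval4 (f x) v)"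
  by (induction A rule: infinite_finite_induct) auto

lemma monom_val_add: "monom_val v (a + b) = monom_val v a * monom_val v b"
  by (simp add: lookup_add power_add prod.distrib)

lemma eval4_mult [simp]: "eval4 (F * G) v = eval4 F v * eval4 G v"
proof -
  have "F * G = (\<Sum>a\<in>Poly_Mapping.keys F. \<Sum>b\<in>Poly_Mapping.keys G.
      Poly_Mapping.single (a + b) (Poly_Mapping.lookup F a * Poly_Mapping.lookup G b))"
    by (subst (1) sum_monomials[of F], subst (1) sum_monomials[of G])
      (simp add: sum_product mult_single)
  then have "eval4 (F * G) v = (\<Sum>a\<in>Poly_Mapping.keys F. \<Sum>b\<in>Poly_Mapping.keys G.
      (Poly_Mapping.lookup F a * monom_val v a) * (Poly_Mapping.lookup G b * monom_val v b))"
    by (simp only: eval4_sum eval4_single monom_val_add mult_ac)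
  also have "\<dots> = eval4 F v * eval4 G v"
    unfolding eval4_def by (simp add: sum_product)
  finally show ?thesis .
qed

lemma eval4_uminus [simp]: "eval4 (- F) v = - eval4 F v"
  using eval4_add[of F "- F" v] by (simp add: eq_neg_iff_add_eq_0 add.commute)

lemma eval4_diff [simp]: "eval4 (F - G) v = eval4 F v - eval4 G v"
  using eval4_add[of F "- G" v] by simp

lemma eval4_power [simp]: "eval4 (F ^ n) v = eval4 F v ^ n"
  by (induction n) auto

lemma eval4_prod [simp]: "eval4 (prod f A) v = (\<Prod>x\<in>A. eval4 (f x) v)"
  by (induction A rule: infinite_finite_induct) auto

lemma eval4_scale4 [simp]: "eval4 (scale4 c F) v = c * eval4 F v"
  by (simp add: scale4_def)

lemma lookup_scale4 [simp]: "Poly_Mapping.lookup (scale4 c F) a = c * Poly_Mapping.lookup F a"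
  unfolding scale4_def by (simp flip: mult_map_scale_conv_mult add: map.rep_eq when_def)

lemma keys_scale4: "Poly_Mapping.keys (scale4 c F) \<subseteq> Poly_Mapping.keys F"
  by (auto simp: in_keys_iff)

lemma eval4_var4 [simp]: "eval4 (var4 i) v = v $ i"
proof -
  have "(\<Prod>j\<in>UNIV. v $ j ^ Poly_Mapping.lookup (Poly_Mapping.single i (1::nat)) j) =
      (\<Prod>j\<in>UNIV. if j = i then v $ j else 1)"
    by (intro prod.cong) (auto simp: lookup_single)
  then show ?thesis by (simp add: var4_def)
qed

section \<open>Linear forms and the pairing of coordinate vectors\<close>

definition dot :: "'k::comm_ring_1 ^ 4 \<Rightarrow> 'k ^ 4 \<Rightarrow> 'k" where
  "dot a v = (\<Sum>i\<in>UNIV. a $ i * v $ i)"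

lemma dot_commute: "dot a v = dot v a"
  by (simp add: dot_def mult.commute)

lemma dot_add_right [simp]: "dot a (u + v) = dot a u + dot a v"
  by (simp add: dot_def algebra_simps sum.distrib)

lemma dot_scale_right [simp]: "dot a (c *s v) = c * dot a v"
  unfolding dot_def sum_distrib_left by (intro sum.cong) (simp_all add: mult_ac)

lemma dot_add_left [simp]: "dot (u + v) a = dot u a + dot v a"
  by (simp add: dot_def algebra_simps sum.distrib)

lemma dot_scale_left [simp]: "dot (c *s v) a = c * dot v a"
  unfolding dot_def sum_distrib_left by (intro sum.cong) (simp_all add: mult_ac)

lemma dot_diff_left [simp]: "dot (u - v) a = dot u a - dot v a"
  by (simp add: dot_def algebra_simps sum_subtractf)

lemma dot_0 [simp]: "dot a 0 = 0" "dot 0 a = 0"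
  by (simp_all add: dot_def)

lemma dot_sum_right [simp]: "dot a (sum f A) = (\<Sum>x\<in>A. dot a (f x))"
  by (induction A rule: infinite_finite_induct) auto

lemma eval4_linear_form [simp]: "eval4 (linear_form a) v = dot a v"
  by (simp add: linear_form_def dot_def)

section \<open>Graded pieces of the polynomial ring\<close>

lemma monom_degree_0 [simp]: "monom_degree 0 = 0"
  by (simp add: monom_degree_def)

lemma monom_degree_add: "monom_degree (a + b) = monom_degree a + monom_degree b"
  by (simp add: monom_degree_def lookup_add sum.distrib)

lemma monom_degree_single [simp]: "monom_degree (Poly_Mapping.single i n) = n"
  by (simp add: monom_degree_def lookup_single when_def)

lemma monom_degree_eq_0_iff [simp]: "monom_degree a = 0 \<longleftrightarrow> a = 0"
  by (auto simp: monom_degree_def poly_mapping_eq_iff fun_eq_iff)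

lemma forms_lookup: "F \<in> forms t \<Longrightarrow> monom_degree a \<noteq> t \<Longrightarrow> Poly_Mapping.lookup F a = 0"
  by (auto simp: forms_def in_keys_iff)

lemma formsI: "(\<And>a. Poly_Mapping.lookup F a \<noteq> 0 \<Longrightarrow> monom_degree a = t) \<Longrightarrow> F \<in> forms t"
  by (auto simp: forms_def in_keys_iff)

lemma forms_0 [simp, intro]: "0 \<in> forms t"
  by (simp add: forms_def)

lemma forms_add: "F \<in> forms t \<Longrightarrow> G \<in> forms t \<Longrightarrow> F + G \<in> forms t"
  by (rule formsI) (metis forms_lookup lookup_add add_0)

lemma forms_scale4: "F \<in> forms t \<Longrightarrow> scale4 c F \<in> forms t"
  by (rule formsI) (metis forms_lookup lookup_scale4 mult_zero_right)

lemma subspace_forms: "poly4.subspace (forms t)"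
  by (simp add: poly4.subspace_def forms_add forms_scale4)

lemma forms_diff: "F \<in> forms t \<Longrightarrow> G \<in> forms t \<Longrightarrow> F - G \<in> forms t"
  by (rule formsI) (metis forms_lookup lookup_minus diff_zero)

lemma forms_sum: "(\<And>x. x \<in> A \<Longrightarrow> f x \<in> forms t) \<Longrightarrow> sum f A \<in> forms t"
  by (induction A rule: infinite_finite_induct) (auto intro: forms_add)

lemma forms_mult: "F \<in> forms s \<Longrightarrow> G \<in> forms t \<Longrightarrow> F * G \<in> forms (s + t)"
  unfolding forms_def using keys_mult[of F G] by (fastforce simp: monom_degree_add)

lemma forms_single: "monom_degree a = t \<Longrightarrow> Poly_Mapping.single a c \<in> forms t"
  by (auto simp: forms_def split: if_splits)

lemma forms_1: "1 \<in> forms 0"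
  unfolding single_one[symmetric] by (rule forms_single) simp

lemma forms_power: "F \<in> forms s \<Longrightarrow> F ^ n \<in> forms (s * n)"
proof (induction n)
  case (Suc n)
  then show ?case using forms_mult[of F s "F ^ n" "s * n"] by simp
qed (simp add: forms_1)

lemma forms_prod:
  "finite A \<Longrightarrow> (\<And>x. x \<in> A \<Longrightarrow> f x \<in> forms 1) \<Longrightarrow> prod f A \<in> forms (card A)"
proof (induction A rule: finite_induct)
  case (insert x A)
  then show ?case using forms_mult[of "f x" 1 "prod f A" "card A"] by simp
qed (simp add: forms_1)

lemma linear_form_forms: "linear_form a \<in> forms 1"
  unfolding linear_form_def var4_def by (intro forms_sum forms_scale4 forms_single) simp

lemmas linear_form_forms_Suc_0 [simp] = linear_form_forms [unfolded One_nat_def]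

lemma linear_form_power_forms: "linear_form a ^ n \<in> forms n"
  using forms_power[OF linear_form_forms[of a], of n] by simp

lemma linear_form_eq_0_iff [simp]:
  fixes a :: "'k::comm_ring_1 ^ 4"
  shows "linear_form a = 0 \<longleftrightarrow> a = 0"
proof
  assume "linear_form a = 0"
  then have "dot a (axis i 1) = 0" for i
    by (metis eval4_0 eval4_linear_form)
  moreover have "dot a (axis i 1) = a $ i" for i
    by (simp add: dot_def axis_def if_distrib cong: if_cong)
  ultimately show "a = 0" by (simp add: vec_eq_iff)
qed (simp add: linear_form_def scale4_def)

lemma eval4_forms_scale:
  assumes "F \<in> forms t"
  shows "eval4 F (c *s v) = c ^ t * eval4 F v"
proof -
  have "monom_val (c *s v) a = c ^ monom_degree a * monom_val v a" for a
    by (simp add: power_mult_distrib prod.distrib power_sum monom_degree_def)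
  then show ?thesis using assms
    unfolding eval4_def sum_distrib_left by (intro sum.cong) (auto simp: forms_def)
qed

lemma finite_monom_degree: "finite {a. monom_degree a = t}"
proof (rule finite_subset)
  let ?f = "\<lambda>a. (\<lambda>i::4. Poly_Mapping.lookup a i :: nat)"
  have "Poly_Mapping.lookup a i \<le> monom_degree a" for a :: monom4 and i
    unfolding monom_degree_def by (intro member_le_sum) auto
  then show "{a. monom_degree a = t} \<subseteq> ?f -` (PiE UNIV (\<lambda>_. {..t}))"
    by auto
  show "finite (?f -` (PiE UNIV (\<lambda>_. {..t})))"
  proof (rule finite_vimageI)
    show "finite (PiE (UNIV :: 4 set) (\<lambda>_. {..t}))"
      by (rule finite_PiE) auto
    show "inj ?f"
      by (rule injI) (rule poly_mapping_eqI, metis)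
  qed
qed

lemma forms_in_span:
  "forms t \<subseteq> poly4.span ((\<lambda>a. Poly_Mapping.single a (1::'k::field)) ` {a. monom_degree a = t})"
proof
  fix F :: "'k poly4" assume F: "F \<in> forms t"
  have "Poly_Mapping.single a (Poly_Mapping.lookup F a)
      = scale4 (Poly_Mapping.lookup F a) (Poly_Mapping.single a 1)" for a
    by (simp add: scale4_def mult_single)
  then have *: "F = (\<Sum>a\<in>Poly_Mapping.keys F. scale4 (Poly_Mapping.lookup F a) (Poly_Mapping.single a 1))"
    using sum_monomials[of F] by simp
  show "F \<in> poly4.span ((\<lambda>a. Poly_Mapping.single a 1) ` {a. monom_degree a = t})"
    by (subst *, intro poly4.span_sum poly4.span_scale poly4.span_base)
      (use F in \<open>auto simp: forms_def\<close>)
qed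

section \<open>Hilbert functions and Bezout's theorem for a space curve\<close>

text \<open>Every functional is the dot product with the vector of its values on the standard basis,
  which turns a separating functional into a hyperplane.\<close>

lemma separating_covector:
  fixes v :: "'k::field ^ 4"
  assumes "v \<notin> vec.span S"
  obtains a where "\<And>u. u \<in> S \<Longrightarrow> dot a u = 0" "dot a v = 1"
proof -
  obtain \<phi> where \<phi>: "\<And>u v. \<phi> (u + v) = \<phi> u + \<phi> v" "\<And>c u. \<phi> (c *s u) = c * \<phi> u"
    "\<And>s. s \<in> S \<Longrightarrow> \<phi> s = 0" "\<phi> v = 1"
    using vec.separating_functional[OF assms] by metis
  have \<phi>0: "\<phi> 0 = 0" using \<phi>(2)[of 0 0] by simp
  have \<phi>_sum: "\<phi> (sum f A) = (\<Sum>x\<in>A. \<phi> (f x))" for f :: "4 \<Rightarrow> 'k ^ 4" and A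
    by (induction A rule: infinite_finite_induct) (simp_all add: \<phi> \<phi>0)
  define a where "a = (\<chi> i. \<phi> (axis i 1))"
  have "\<phi> u = dot a u" for u
  proof -
    have "\<phi> u = \<phi> (\<Sum>i\<in>UNIV. u $ i *s axis i 1)" by (simp only: basis_expansion)
    also have "\<dots> = dot a u" by (simp add: \<phi>_sum \<phi>(2) a_def dot_def mult.commute)
    finally show ?thesis .
  qed
  with \<phi> show thesis by (intro that[of a]) auto
qed

lemma exists_covector_nonzero:
  fixes v :: "'k::field ^ 4"
  assumes "v \<noteq> 0"
  obtains a where "dot a v = 1"
  using separating_covector[of v "{}"] assms by auto

section \<open>Projective points and the vanishing ideal\<close>

lemma mem_span_single: "u \<in> vec.span {v} \<longleftrightarrow> (\<exists>c. u = c *s v)"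
  by (auto simp: vec.span_singleton)

lemma span_single_eq:
  assumes "u \<in> vec.span {v}" "u \<noteq> 0"
  shows "vec.span {u} = vec.span {v}"
proof -
  obtain c where c: "u = c *s v" "c \<noteq> 0"
    using assms by (auto simp: mem_span_single)
  then have "v = (1 / c) *s u" by simp
  then have "v \<in> vec.span {u}" by (auto simp: mem_span_single)
  with assms show ?thesis
    by (intro antisym vec.span_minimal) auto
qed

text \<open>Homogeneity spreads a zero at one spanning vector over the whole line.\<close>

lemma vanishes_at_span_iff:
  assumes "F \<in> forms t" "v \<noteq> 0"
  shows "vanishes_at F (vec.span {v}) \<longleftrightarrow> eval4 F v = 0"
proof
  assume "vanishes_at F (vec.span {v})"
  then show "eval4 F v = 0" by (simp add: vanishes_at_def vec.span_base)
next
  assume "eval4 F v = 0"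
  then show "vanishes_at F (vec.span {v})"
    using eval4_forms_scale[OF assms(1)] by (auto simp: vanishes_at_def mem_span_single)
qed

lemma mem_vanishing_ideal_iff: "F \<in> vanishing_ideal Y \<longleftrightarrow> (\<forall>v\<in>\<Union>Y. eval4 F v = 0)"
  by (auto simp: vanishing_ideal_def vanishes_at_def)

lemma vanishing_idealD: "F \<in> vanishing_ideal Y \<Longrightarrow> v \<in> \<Union>Y \<Longrightarrow> eval4 F v = 0"
  unfolding mem_vanishing_ideal_iff by blast

lemma subspace_vanishing_ideal: "poly4.subspace (vanishing_ideal Y)"
  by (auto simp: poly4.subspace_def mem_vanishing_ideal_iff)

lemma subspace_vanishing_forms: "poly4.subspace (vanishing_ideal Y \<inter> forms t)"
  using subspace_vanishing_ideal[of Y] subspace_forms[of t] by (auto simp: poly4.subspace_def)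

abbreviation indep_mod_ideal :: "('k::field ^ 4) set set \<Rightarrow> 'c set \<Rightarrow> ('c \<Rightarrow> 'k poly4) \<Rightarrow> bool" where
  "indep_mod_ideal Y \<equiv> poly4.indep_family_mod (vanishing_ideal Y)"

text \<open>Combinations of forms of degree \<open>t\<close> have degree \<open>t\<close>, so the
  whole ideal can replace its graded piece.\<close>

lemma indep_mod_ideal_forms:
  assumes "f ` J \<subseteq> forms t"
  shows "poly4.indep_family_mod (vanishing_ideal Y \<inter> forms t) J f \<longleftrightarrow> indep_mod_ideal Y J f"
proof -
  have "(\<Sum>j\<in>J. scale4 (c j) (f j)) \<in> forms t" for c
    using assms by (intro forms_sum forms_scale4) auto
  then show ?thesis by (simp add: poly4.indep_family_mod_def)
qed

text \<open>Lower bounds for the Hilbert function come from exhibiting independent families in the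
  coordinate ring; the next lemma shows that the bound is attained.\<close>

lemma indep_card_le_hilbert:
  assumes "finite J" "f ` J \<subseteq> forms t" "indep_mod_ideal Y J f"
  shows "card J \<le> hilbert_function (vanishing_ideal Y) t"
  unfolding hilbert_function_def
  using assms subspace_vanishing_forms[of Y t] forms_in_span[of t]
    finite_monom_degree[of t]
  by (intro poly4.indep_family_mod_card_le[of J _ f "forms t"])
    (auto simp: indep_mod_ideal_forms)

lemma hilbert_indep_exists:
  obtains f where "f ` {..<hilbert_function (vanishing_ideal Y) t} \<subseteq> forms t"
    "indep_mod_ideal Y {..<hilbert_function (vanishing_ideal Y) t} f"
proof -
  obtain f where f: "poly4.indep_family_mod (vanishing_ideal Y \<inter> forms t)
      {..<hilbert_function (vanishing_ideal Y) t} f"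
    "f ` {..<hilbert_function (vanishing_ideal Y) t} \<subseteq> forms t"
    unfolding hilbert_function_def
    by (rule poly4.indep_family_mod_exists[of "vanishing_ideal Y \<inter> forms t" "forms t"])
      (use subspace_vanishing_forms[of Y t] forms_in_span[of t]
        finite_monom_degree[of t] in auto)
  then show thesis using indep_mod_ideal_forms[of f] that by blast
qed

locale space_curve =
  fixes C :: "('k::{alg_closed_field, field_char_0} ^ 4) set set" and d :: nat
  assumes curve: "irreducible_curve C" and nondeg: "nondegenerate C" and deg: "has_degree C d"
begin

abbreviation "I \<equiv> vanishing_ideal C"

lemma subset_proj_space: "C \<subseteq> proj_space"
  using curve by (auto simp: irreducible_curve_def irreducible_closed_def zariski_closed_def zero_locus_def)

lemma curve_point:
  assumes "p \<in> C"
  obtains v where "v \<noteq> 0" "p = vec.span {v}" "v \<in> \<Union>C"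
proof -
  obtain v where v: "v \<noteq> 0" "p = vec.span {v}"
    using assms subset_proj_space by (auto simp: proj_space_def)
  then have "v \<in> p" by (simp add: vec.span_base)
  with v assms show thesis by (intro that) auto
qed

text \<open>Dimension one makes the Hilbert polynomial linear with leading coefficient
  \<open>d\<close>; the remaining point is that its constant term is an integer.\<close>

lemma hilbert_linear:
  obtains t0 :: nat and c :: int where
    "\<And>t. t \<ge> t0 \<Longrightarrow> int (hilbert_function I t) = int d * int t + c"
proof -
  obtain P where P: "is_hilbert_polynomial I P" "enat (degree P) = proj_dim C"
      "of_nat d = fact (degree P) * lead_coeff P"
    using deg by (auto simp: has_degree_def)
  have deg1: "degree P = 1"
    using P(2) curve by (simp add: irreducible_curve_def one_enat_def)
  then have "poly P x = of_nat d * x + coeff P 0" for x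
    using P(3) by (simp add: poly_altdef)
  then obtain t0 where t0: "\<And>t. t \<ge> t0 \<Longrightarrow> of_nat (hilbert_function I t) = of_nat d * of_nat t + coeff P 0"
    using P(1) by (auto simp: is_hilbert_polynomial_def eventually_sequentially)
  \<comment> \<open>Reading the constant off one value in the linear range shows that it is an
    integer.\<close>
  define c where "c = int (hilbert_function I t0) - int d * int t0"
  have "of_int (int (hilbert_function I t)) = (of_int (int d * int t + c) :: rat)" if "t \<ge> t0" for t
    using t0[OF that] t0[of t0] by (simp add: c_def)
  then have "int (hilbert_function I t) = int d * int t + c" if "t \<ge> t0" for t
    using that of_int_eq_iff by blast
  then show thesis by (rule that)
qed

text \<open>The zero loci of \<open>F\<close> and \<open>G\<close> cut \<open>C\<close> into two
  closed parts, and irreducibility makes one of them all of \<open>C\<close>.\<close>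

lemma prime:
  assumes "F \<in> forms s" "G \<in> forms t" "F * G \<in> I"
  shows "F \<in> I \<or> G \<in> I"
proof -
  obtain S where S: "S \<subseteq> (\<Union>t. forms t)" "C = zero_locus S"
    using curve by (auto simp: irreducible_curve_def irreducible_closed_def zariski_closed_def)
  have cl: "zariski_closed (C \<inter> zero_locus {H})" if "H \<in> forms u" for H u
    unfolding zariski_closed_def
    by (rule exI[of _ "insert H S"]) (use that S in \<open>auto simp: zero_locus_def\<close>)
  have "p \<in> zero_locus {F} \<or> p \<in> zero_locus {G}" if p: "p \<in> C" for p
  proof -
    obtain v where v: "v \<noteq> 0" "p = vec.span {v}"
      using p subset_proj_space by (auto simp: proj_space_def)
    have "v \<in> \<Union>C" using v p vec.span_base[of v "{v}"] by blast
    then have "eval4 F v * eval4 G v = 0"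
      using vanishing_idealD[OF assms(3)] by simp
    moreover have "p \<in> proj_space" using p subset_proj_space by auto
    ultimately show ?thesis using v assms
      by (auto simp: zero_locus_def vanishes_at_span_iff)
  qed
  then have "C = (C \<inter> zero_locus {F}) \<union> (C \<inter> zero_locus {G})" by blast
  then have "C = C \<inter> zero_locus {F} \<or> C = C \<inter> zero_locus {G}"
    using curve cl[OF assms(1)] cl[OF assms(2)]
    unfolding irreducible_curve_def irreducible_closed_def by meson
  then have "C \<subseteq> zero_locus {F} \<or> C \<subseteq> zero_locus {G}" by blast
  then show ?thesis by (auto simp: vanishing_ideal_def zero_locus_def)
qed

lemma one_notin_ideal: "1 \<notin> I"
proof -
  obtain p where "p \<in> C" using curve by (auto simp: irreducible_curve_def irreducible_closed_def)
  then obtain v where "v \<in> \<Union>C" by (rule curve_point)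
  then show ?thesis by (auto simp: mem_vanishing_ideal_iff)
qed

lemma linear_form_notin_ideal:
  assumes "a \<noteq> 0"
  shows "linear_form a \<notin> I"
proof
  assume "linear_form a \<in> I"
  then have "C \<subseteq> zero_locus {linear_form a}"
    using subset_proj_space by (auto simp: vanishing_ideal_def zero_locus_def)
  then show False using nondeg assms linear_form_forms[of a] linear_form_eq_0_iff[of a]
    unfolding nondegenerate_def by blast
qed

lemma prod_linear_forms_notin_ideal:
  assumes "finite A" "\<And>x. x \<in> A \<Longrightarrow> f x \<noteq> 0"
  shows "(\<Prod>x\<in>A. linear_form (f x)) \<notin> I"
  using assms
proof (induction A rule: finite_induct)
  case (insert x A)
  then show ?case
    using prime[OF linear_form_forms[of "f x"] forms_prod[of A "\<lambda>x. linear_form (f x)"]]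
    linear_form_notin_ideal[of "f x"] by auto
qed (simp add: one_notin_ideal)

text \<open>For each other point take a plane through it that misses \<open>p\<close>; the product
  of these planes is brought up to degree \<open>t\<close> by a linear form that does not vanish at
  \<open>p\<close>.\<close>

lemma separate_points:
  assumes "finite Z" "Z \<subseteq> C" "p \<in> Z" "card Z \<le> t + 1"
  shows "\<exists>E\<in>forms t. \<not> vanishes_at E p \<and> (\<forall>q\<in>Z - {p}. vanishes_at E q)"
proof -
  obtain v where v: "v \<noteq> 0" "p = vec.span {v}"
    using assms subset_proj_space by (auto simp: proj_space_def)
  have "\<exists>a. dot a v = 1 \<and> (\<forall>u\<in>q. dot a u = 0)" if q: "q \<in> Z - {p}" for q
  proof -
    obtain w where w: "w \<noteq> 0" "q = vec.span {w}"
      using q assms subset_proj_space by (auto simp: proj_space_def)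
    have "v \<notin> vec.span {w}" using span_single_eq[of v w] v w q by auto
    then obtain a where "dot a w = 0" "dot a v = 1" using separating_covector by blast
    then show ?thesis using w by (intro exI[of _ a]) (auto simp: mem_span_single)
  qed
  then obtain a where a: "\<And>q. q \<in> Z - {p} \<Longrightarrow> dot (a q) v = 1"
    "\<And>q u. q \<in> Z - {p} \<Longrightarrow> u \<in> q \<Longrightarrow> dot (a q) u = 0" by metis
  obtain n where n: "dot n v = 1" using exists_covector_nonzero[OF v(1)] by blast
  define E where "E = linear_form n ^ (t - card (Z - {p})) * (\<Prod>q\<in>Z - {p}. linear_form (a q))"
  have "card (Z - {p}) \<le> t" using assms by simp
  then have "E \<in> forms t"
    using forms_mult[OF linear_form_power_forms[of n "t - card (Z - {p})"]
        forms_prod[of "Z - {p}" "\<lambda>q. linear_form (a q)"]] assms(1)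
    by (simp add: E_def)
  moreover have "eval4 E v = 1" using a(1) by (simp add: E_def n)
  then have "\<not> vanishes_at E p"
    unfolding v(2) using vanishes_at_span_iff[OF \<open>E \<in> forms t\<close> v(1)] by simp
  moreover have "vanishes_at E q" if "q \<in> Z - {p}" for q
  proof -
    have "(\<Prod>q\<in>Z - {p}. dot (a q) u) = 0" if "u \<in> q" for u
      using \<open>q \<in> Z - {p}\<close> that a(2) assms(1) by (intro prod_zero) auto
    then show ?thesis by (simp add: vanishes_at_def E_def)
  qed
  ultimately show ?thesis by blast
qed

text \<open>If \<open>F\<close> were outside the prime ideal, multiplication by it would be
  injective on the coordinate ring. Its multiples vanish on \<open>Z\<close>, so forms separating
  the points of \<open>Z\<close> are independent of them, and the Hilbert function would grow by at
  least \<open>card Z\<close> over \<open>k\<close> degrees, whereas it grows by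
  \<open>d * k\<close>.\<close>

lemma bezout:
  assumes "F \<in> forms k" "Z \<subseteq> C" "finite Z" "card Z > d * k" "\<And>p. p \<in> Z \<Longrightarrow> vanishes_at F p"
  shows "F \<in> I"
proof (rule ccontr)
  assume "F \<notin> I"
  obtain t0 c where hf: "\<And>t. t \<ge> t0 \<Longrightarrow> int (hilbert_function I t) = int d * int t + c"
    using hilbert_linear by blast
  \<comment> \<open>Large enough for the linear range of the Hilbert function and for separating the
    points in degree \<open>k + s\<close>.\<close>
  define s where "s = t0 + card Z"
  define h where "h = hilbert_function I s"
  obtain f where f: "f ` {..<h} \<subseteq> forms s" "indep_mod_ideal C {..<h} f"
    unfolding h_def by (rule hilbert_indep_exists)
  have "\<forall>p\<in>Z. \<exists>E\<in>forms (k + s). \<not> vanishes_at E p \<and> (\<forall>q\<in>Z - {p}. vanishes_at E q)"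
    using separate_points[OF assms(3,2)] by (simp add: s_def)
  then obtain E where E: "\<And>p. p \<in> Z \<Longrightarrow> E p \<in> forms (k + s)" "\<And>p. p \<in> Z \<Longrightarrow> \<not> vanishes_at (E p) p"
    "\<And>p q. p \<in> Z \<Longrightarrow> q \<in> Z - {p} \<Longrightarrow> vanishes_at (E p) q" by metis
  \<comment> \<open>Left indices carry the multiples of \<open>F\<close>, right indices the
    separating forms.\<close>
  define g where "g = case_sum (\<lambda>i. F * f i) E"
  let ?J = "{..<h} <+> Z"
  have gJ: "g ` ?J \<subseteq> forms (k + s)"
    using E(1) f(1) forms_mult[OF assms(1)] by (auto simp: g_def Plus_def)
  have "indep_mod_ideal C ?J g"
    unfolding poly4.indep_family_mod_def
  proof (intro allI impI)
    fix a assume a: "(\<Sum>j\<in>?J. scale4 (a j) (g j)) \<in> I"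
    let ?H = "\<Sum>i<h. scale4 (a (Inl i)) (f i)"
    have sum_eq: "(\<Sum>j\<in>?J. scale4 (a j) (g j)) = F * ?H + (\<Sum>p\<in>Z. scale4 (a (Inr p)) (E p))"
      using assms(3) by (simp add: sum.Plus g_def sum_distrib_left scale4_def mult_ac)
    \<comment> \<open>At a vector of \<open>p\<close> the multiples of \<open>F\<close> and all
      separating forms except \<open>E p\<close> vanish.\<close>
    have aZ: "a (Inr p) = 0" if p: "p \<in> Z" for p
    proof -
      obtain v where v: "v \<in> p" "eval4 (E p) v \<noteq> 0" using E(2)[OF p] by (auto simp: vanishes_at_def)
      have "v \<in> \<Union>C" using v p assms(2) by auto
      then have "0 = eval4 (F * ?H + (\<Sum>p\<in>Z. scale4 (a (Inr p)) (E p))) v"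
        by (rule vanishing_idealD[OF a[unfolded sum_eq], symmetric])
      also have "\<dots> = (\<Sum>q\<in>Z. a (Inr q) * eval4 (E q) v)"
        using assms(5)[OF p] v(1) by (simp add: vanishes_at_def)
      also have "\<dots> = (\<Sum>q\<in>{p}. a (Inr q) * eval4 (E q) v)"
        using assms(3) p E(3)[of _ p] v(1)
        by (intro sum.mono_neutral_right) (auto simp: vanishes_at_def)
      finally show ?thesis using v(2) by simp
    qed
    then have "F * ?H \<in> I" using a unfolding sum_eq by simp
    moreover have "?H \<in> forms s" using f(1) by (intro forms_sum forms_scale4) auto
    ultimately have "?H \<in> I" using prime[OF assms(1)] \<open>F \<notin> I\<close> by blast
    then have "\<forall>i<h. a (Inl i) = 0"
      using f(2)[unfolded poly4.indep_family_mod_def, rule_format, of "\<lambda>i. a (Inl i)"] by auto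
    then show "\<forall>j\<in>?J. a j = 0" using aZ by (auto simp: Plus_def)
  qed
  then have "h + card Z \<le> hilbert_function I (k + s)"
    using indep_card_le_hilbert[OF _ gJ] assms(3) by (simp add: card_Plus)
  then have "int h + int (card Z) \<le> int (hilbert_function I (k + s))" by linarith
  then have "int (card Z) \<le> int d * int k"
    using hf[of s] hf[of "k + s"] by (simp add: h_def s_def distrib_left)
  then show False using assms(4) by (simp flip: of_nat_mult)
qed

end

section \<open>Polynomials in two variables\<close>

text \<open>Plane polynomials are encoded with inner variable \<open>s\<close> and outer variable
  \<open>x\<close>; in the application these are the affine coordinates \<open>x_1/x_0\<close> and
  \<open>x_2/x_0\<close>.\<close>

definition eval2 :: "'k::comm_ring_1 poly poly \<Rightarrow> 'k \<Rightarrow> 'k \<Rightarrow> 'k" where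
  "eval2 W s x = poly (poly W [:x:]) s"

lemma eval2_simps [simp]:
  "eval2 0 s x = 0" "eval2 1 s x = 1"
  "eval2 (W + V) s x = eval2 W s x + eval2 V s x"
  "eval2 (W - V) s x = eval2 W s x - eval2 V s x"
  "eval2 (W * V) s x = eval2 W s x * eval2 V s x"
  "eval2 (W ^ n) s x = eval2 W s x ^ n"
  "eval2 [:p:] s x = poly p s"
  "eval2 (smult p W) s x = poly p s * eval2 W s x"
  by (simp_all add: eval2_def)

lemma eval2_sum [simp]: "eval2 (sum f A) s x = (\<Sum>i\<in>A. eval2 (f i) s x)"
  by (induction A rule: infinite_finite_induct) auto

lemma eval2_prod [simp]: "eval2 (prod f A) s x = (\<Prod>i\<in>A. eval2 (f i) s x)"
  by (induction A rule: infinite_finite_induct) auto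

lemma poly_eq_sum:
  fixes p :: "'a::comm_semiring_1 poly"
  shows "degree p \<le> n \<Longrightarrow> poly p x = (\<Sum>i\<le>n. coeff p i * x ^ i)"
  unfolding poly_altdef by (rule sum.mono_neutral_left) (auto simp: coeff_eq_0)

text \<open>Only finitely many constants \<open>[:x:]\<close> are roots of the outer polynomial; any
  other \<open>x\<close> leaves a nonzero polynomial in \<open>s\<close>.\<close>

lemma exists_eval2_nonzero:
  fixes W :: "'k::field_char_0 poly poly"
  assumes "W \<noteq> 0"
  obtains s x where "eval2 W s x \<noteq> 0"
proof -
  have "finite {p. poly W p = 0}" using assms by (rule poly_roots_finite)
  moreover have "infinite (range (\<lambda>x :: 'k. [:x:]))"
    using infinite_UNIV_char_0[where 'a = 'k] by (auto dest!: finite_imageD simp: inj_def)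
  ultimately obtain x where x: "poly W [:x:] \<noteq> 0"
    by (metis (mono_tags, lifting) finite_subset image_subset_iff mem_Collect_eq)
  have "finite {s. poly (poly W [:x:]) s = 0}" using x by (rule poly_roots_finite)
  then obtain s where "poly (poly W [:x:]) s \<noteq> 0"
    using infinite_UNIV_char_0[where 'a = 'k] by (metis (mono_tags, lifting) finite_subset mem_Collect_eq subsetI)
  then show thesis using that by (simp add: eval2_def)
qed

text \<open>A bound on the total degree, while \<open>degree\<close> measures the outer variable
  alone; division and homogenization depend on comparing the two.\<close>

definition tdeg_le :: "nat \<Rightarrow> 'k::comm_ring_1 poly poly \<Rightarrow> bool" where
  "tdeg_le t W \<longleftrightarrow> (\<forall>i j. coeff (coeff W i) j \<noteq> 0 \<longrightarrow> i + j \<le> t)"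

lemma tdeg_le_coeff: "tdeg_le t W \<Longrightarrow> i + j > t \<Longrightarrow> coeff (coeff W i) j = 0"
  unfolding tdeg_le_def by (meson leD)

lemma tdeg_le_mono: "tdeg_le t W \<Longrightarrow> t \<le> u \<Longrightarrow> tdeg_le u W"
  by (meson order_trans tdeg_le_def)

lemma tdeg_le_0 [simp]: "tdeg_le t 0"
  by (simp add: tdeg_le_def)

lemma tdeg_le_add: "tdeg_le t W \<Longrightarrow> tdeg_le t V \<Longrightarrow> tdeg_le t (W + V)"
  unfolding tdeg_le_def by (metis add_0 coeff_add)

lemma tdeg_le_diff: "tdeg_le t W \<Longrightarrow> tdeg_le t V \<Longrightarrow> tdeg_le t (W - V)"
  unfolding tdeg_le_def by (metis diff_zero coeff_diff)

lemma tdeg_le_sum: "(\<And>x. x \<in> A \<Longrightarrow> tdeg_le t (f x)) \<Longrightarrow> tdeg_le t (sum f A)"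
  by (induction A rule: infinite_finite_induct) (auto intro: tdeg_le_add)

lemma coeff_coeff_mult:
  "coeff (coeff (W * V) i) j =
    (\<Sum>i1\<le>i. \<Sum>j1\<le>j. coeff (coeff W i1) j1 * coeff (coeff V (i - i1)) (j - j1))"
  by (simp add: coeff_mult coeff_sum)

lemma tdeg_le_mult:
  assumes "tdeg_le t W" "tdeg_le u V"
  shows "tdeg_le (t + u) (W * V)"
  unfolding tdeg_le_def
proof (intro allI impI, rule ccontr)
  fix i j assume ne: "coeff (coeff (W * V) i) j \<noteq> 0" and gt: "\<not> i + j \<le> t + u"
  have "coeff (coeff W i1) j1 * coeff (coeff V (i - i1)) (j - j1) = 0" if "i1 \<le> i" "j1 \<le> j" for i1 j1
  proof (cases "i1 + j1 > t")
    case False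
    then have "i - i1 + (j - j1) > u" using gt that by linarith
    then show ?thesis by (simp add: tdeg_le_coeff[OF assms(2)])
  qed (simp add: tdeg_le_coeff[OF assms(1)])
  then show False using ne by (simp add: coeff_coeff_mult)
qed

lemma tdeg_le_const: "tdeg_le 0 [:[:c:]:]"
  by (auto simp: tdeg_le_def coeff_pCons split: nat.splits)

lemma tdeg_le_power: "tdeg_le t W \<Longrightarrow> tdeg_le (t * n) (W ^ n)"
proof (induction n)
  case 0
  then show ?case using tdeg_le_const[of 1] by (simp add: one_pCons[symmetric])
next
  case (Suc n)
  then show ?case using tdeg_le_mult[of t W "t * n" "W ^ n"] by simp
qed

lemma tdeg_le_prod:
  "(\<And>x. x \<in> A \<Longrightarrow> tdeg_le (t x) (f x)) \<Longrightarrow> tdeg_le (\<Sum>x\<in>A. t x) (\<Prod>x\<in>A. f x)"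
proof (induction A rule: infinite_finite_induct)
  case (insert x A)
  then show ?case using tdeg_le_mult[of "t x" "f x"] by simp
qed (use tdeg_le_const[of 1] in \<open>simp_all add: one_pCons[symmetric]\<close>)

lemma tdeg_le_degree: "tdeg_le t W \<Longrightarrow> degree W \<le> t"
  by (metis add_leD1 leading_coeff_0_iff coeff_0 degree_0 le0 tdeg_le_def)

lemma tdeg_le_degree_coeff: "tdeg_le t W \<Longrightarrow> degree (coeff W i) \<le> t - i"
  by (intro degree_le) (auto intro!: tdeg_le_coeff)

lemma tdeg_le_monom: "degree c + n \<le> t \<Longrightarrow> tdeg_le t (monom c n)"
  by (auto simp: tdeg_le_def coeff_monom dest: le_degree split: if_splits)

lemma exists_tdeg_le: "\<exists>t. tdeg_le t W"
proof -
  have "tdeg_le (degree W + (\<Sum>i\<le>degree W. degree (coeff W i))) W"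
    unfolding tdeg_le_def
  proof (intro allI impI)
    fix i j assume ne: "coeff (coeff W i) j \<noteq> 0"
    then have i: "i \<le> degree W" by (metis coeff_0 le_degree)
    have "j \<le> degree (coeff W i)" using ne by (rule le_degree)
    also have "\<dots> \<le> (\<Sum>i\<le>degree W. degree (coeff W i))"
      using i by (intro member_le_sum) auto
    finally show "i + j \<le> degree W + (\<Sum>i\<le>degree W. degree (coeff W i))" using i by simp
  qed
  then show ?thesis by blast
qed

lemma eval2_expand:
  assumes "tdeg_le t W"
  shows "eval2 W s x = (\<Sum>i\<le>t. \<Sum>j\<le>t - i. coeff (coeff W i) j * s ^ j * x ^ i)"
proof -
  have "poly (coeff W i) s = (\<Sum>j\<le>t - i. coeff (coeff W i) j * s ^ j)" for i
    by (intro poly_eq_sum tdeg_le_degree_coeff[OF assms])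
  then show ?thesis
    unfolding eval2_def poly_eq_sum[OF tdeg_le_degree[OF assms]]
    by (simp add: poly_sum sum_distrib_right)
qed

section \<open>Leading coefficients and top homogeneous parts\<close>

lemma coeff_mult_top:
  assumes "degree p \<le> m" "degree q \<le> n"
  shows "coeff (p * q) (m + n) = coeff p m * coeff q n"
proof -
  have "coeff p i * coeff q (m + n - i) = 0" if "i \<noteq> m" for i
  proof (cases "i > m")
    case False
    then have "m + n - i > n" using that by linarith
    then show ?thesis using assms(2) by (simp add: coeff_eq_0)
  qed (use assms(1) in \<open>simp add: coeff_eq_0\<close>)
  then have "coeff (p * q) (m + n) = (\<Sum>i\<in>{m}. coeff p i * coeff q (m + n - i))"
    unfolding coeff_mult by (intro sum.mono_neutral_right) auto
  then show ?thesis by simp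
qed

lemma coeff_power_top: "degree p \<le> m \<Longrightarrow> coeff (p ^ n) (m * n) = coeff p m ^ n"
proof (induction n)
  case (Suc n)
  then have "degree (p ^ n) \<le> m * n"
    by (intro order.trans[OF degree_power_le]) simp
  with Suc show ?case using coeff_mult_top[of p m "p ^ n" "m * n"] by simp
qed simp

lemma coeff_prod_top:
  "finite A \<Longrightarrow> (\<And>x. x \<in> A \<Longrightarrow> degree (f x) \<le> m x) \<Longrightarrow>
    coeff (\<Prod>x\<in>A. f x) (\<Sum>x\<in>A. m x) = (\<Prod>x\<in>A. coeff (f x) (m x))"
proof (induction A rule: finite_induct)
  case (insert x A)
  have "degree (prod f A) \<le> (\<Sum>x\<in>A. m x)"
    using insert.hyps insert.prems by (intro order.trans[OF degree_prod_sum_le] sum_mono) auto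
  then show ?case using insert coeff_mult_top[of "f x" "m x" "prod f A"] by simp
qed simp

text \<open>The homogeneous part of total degree \<open>t\<close>, with the inner variable set to
  1.\<close>

definition top_form :: "nat \<Rightarrow> 'k::comm_ring_1 poly poly \<Rightarrow> 'k poly" where
  "top_form t W = (\<Sum>i\<le>t. monom (coeff (coeff W i) (t - i)) i)"

lemma coeff_top_form: "coeff (top_form t W) i = (if i \<le> t then coeff (coeff W i) (t - i) else 0)"
  by (simp add: top_form_def coeff_sum coeff_monom)

text \<open>In total degree \<open>t + u\<close> only products of terms of degrees exactly
  \<open>t\<close> and \<open>u\<close> survive.\<close>

lemma top_form_mult:
  assumes "tdeg_le t W" "tdeg_le u V"
  shows "top_form (t + u) (W * V) = top_form t W * top_form u V"
proof (rule poly_eqI)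
  fix i
  show "coeff (top_form (t + u) (W * V)) i = coeff (top_form t W * top_form u V) i"
  proof (cases "i \<le> t + u")
    case True
    let ?c = "\<lambda>i1 j1. coeff (coeff W i1) j1 * coeff (coeff V (i - i1)) (t + u - i - j1)"
    have "(\<Sum>j1\<le>t + u - i. ?c i1 j1) = coeff (top_form t W) i1 * coeff (top_form u V) (i - i1)"
      if i1: "i1 \<le> i" for i1
    proof (cases "i1 \<le> t \<and> i - i1 \<le> u")
      case le: True
      have "?c i1 j1 = 0" if j1: "j1 \<le> t + u - i" "j1 \<noteq> t - i1" for j1
      proof (cases "i1 + j1 > t")
        case False
        then have "i - i1 + (t + u - i - j1) > u" using j1 le i1 True by linarith
        then show ?thesis by (simp only: tdeg_le_coeff[OF assms(2)] mult_zero_right)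
      qed (simp add: tdeg_le_coeff[OF assms(1)])
      then have "(\<Sum>j1\<le>t + u - i. ?c i1 j1) = (\<Sum>j1\<in>{t - i1}. ?c i1 j1)"
        using le i1 by (intro sum.mono_neutral_right) auto
      also have "\<dots> = coeff (coeff W i1) (t - i1) * coeff (coeff V (i - i1)) (u - (i - i1))"
      proof -
        have "t + u - i - (t - i1) = u - (i - i1)" using le i1 by linarith
        then show ?thesis by simp
      qed
      finally show ?thesis using le by (simp only: coeff_top_form if_True)
    next
      case False
      then have "coeff (top_form t W) i1 * coeff (top_form u V) (i - i1) = 0"
        by (auto simp: coeff_top_form)
      moreover have "?c i1 j1 = 0" for j1
      proof -
        consider "i1 + j1 > t" | "i - i1 + (t + u - i - j1) > u" using False by linarith
        then show ?thesis
          by cases (simp_all only: tdeg_le_coeff[OF assms(1)] tdeg_le_coeff[OF assms(2)]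
              mult_zero_left mult_zero_right)
      qed
      ultimately show ?thesis by simp
    qed
    then have "coeff (coeff (W * V) i) (t + u - i) = coeff (top_form t W * top_form u V) i"
      unfolding coeff_coeff_mult coeff_mult[of "top_form t W"] by (intro sum.cong) auto
    then show ?thesis using True by (simp add: coeff_top_form[of "t + u"])
  next
    case False
    have "coeff (top_form t W) i1 * coeff (top_form u V) (i - i1) = 0" for i1
      using False by (auto simp: coeff_top_form)
    then show ?thesis using False by (simp add: coeff_top_form[of "t + u"] coeff_mult)
  qed
qed

text \<open>For the least bound on the total degree the top part cannot vanish.\<close>

lemma exists_top_form_nonzero:
  assumes "W \<noteq> 0"
  obtains t where "tdeg_le t W" "top_form t W \<noteq> 0"
proof
  define t where "t = (LEAST t. tdeg_le t W)"
  show t: "tdeg_le t W" unfolding t_def using exists_tdeg_le by (rule LeastI_ex)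
  show "top_form t W \<noteq> 0"
  proof
    assume "top_form t W = 0"
    then have top: "coeff (coeff W i) (t - i) = 0" if "i \<le> t" for i
      using coeff_top_form[of t W i] that by simp
    have lt: "i + j < t" if "coeff (coeff W i) j \<noteq> 0" for i j
    proof -
      have le: "i + j \<le> t" using t that by (auto simp: tdeg_le_def)
      moreover have "i + j \<noteq> t" using top[of i] that le by auto
      ultimately show ?thesis by simp
    qed
    show False
    \<comment> \<open>With zero top part the bound drops by one, or nothing is left when it is
      already 0.\<close>
    proof (cases t)
      case 0
      then have "W = 0" using lt by (auto simp: poly_eq_iff)
      then show False using assms by simp
    next
      case (Suc n)
      then have "tdeg_le n W" using lt by (fastforce simp: tdeg_le_def)
      then have "t \<le> n" unfolding t_def by (rule Least_le)
      then show False using Suc by simp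
    qed
  qed
qed

text \<open>Total degree is additive because top parts live in an integral domain, so the product of
  two nonzero ones is nonzero.\<close>

lemma tdeg_le_factor:
  fixes F h :: "'k::field poly poly"
  assumes "tdeg_le a (F * h)" "F * h \<noteq> 0"
  obtains u where "u \<le> a" "tdeg_le u h" "tdeg_le (a - u) F"
proof -
  obtain t where t: "tdeg_le t F" "top_form t F \<noteq> 0"
    using assms by (elim exists_top_form_nonzero[of F, rotated]) auto
  obtain u where u: "tdeg_le u h" "top_form u h \<noteq> 0"
    using assms by (elim exists_top_form_nonzero[of h, rotated]) auto
  have "top_form (t + u) (F * h) \<noteq> 0" using t u by (simp add: top_form_mult)
  then obtain i where i: "coeff (top_form (t + u) (F * h)) i \<noteq> 0"
    by (auto simp: poly_eq_iff)
  then have "i \<le> t + u" "coeff (coeff (F * h) i) (t + u - i) \<noteq> 0"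
    by (auto simp: coeff_top_form split: if_splits)
  then have "t + u \<le> a" using assms(1) unfolding tdeg_le_def by fastforce
  then show thesis using t u by (intro that[of u] tdeg_le_mono[OF t(1)]) auto
qed

section \<open>Division in a prime ideal of the plane\<close>

lemma prime_elem_linear: "prime_elem [:-r, 1 :: 'k::field:]"
  by (auto simp: prime_elem_def is_unit_poly_iff simp flip: poly_eq_0_iff_dvd)

text \<open>These are the properties of the ideal of a projected curve on which division rests. By
  \<open>const\<close>, no nonzero polynomial in the inner variable alone vanishes on the
  curve.\<close>

locale prime_plane_ideal =
  fixes Q :: "'k::alg_closed_field poly poly set"
  assumes zero: "0 \<in> Q"
    and diff: "W \<in> Q \<Longrightarrow> V \<in> Q \<Longrightarrow> W - V \<in> Q"
    and mult: "W \<in> Q \<Longrightarrow> V * W \<in> Q"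
    and prime_ideal: "W * V \<in> Q \<Longrightarrow> W \<in> Q \<or> V \<in> Q"
    and const: "[:c:] \<in> Q \<Longrightarrow> c = 0"
begin

text \<open>Gauss's lemma, with the linear polynomials in the inner variable as the only primes.\<close>

lemma monic_generator:
  assumes "A \<in> Q" "lead_coeff A = 1"
  obtains F h where "F \<in> Q" "F \<noteq> 0" "\<And>G. G \<in> Q \<Longrightarrow> G \<noteq> 0 \<Longrightarrow> degree F \<le> degree G"
    "degree (lead_coeff F) = 0" "A = F * h"
proof -
  have A0: "A \<noteq> 0" using assms by auto
  define e where "e = (LEAST e. \<exists>G\<in>Q. G \<noteq> 0 \<and> degree G = e)"
  have "\<exists>e. \<exists>G\<in>Q. G \<noteq> 0 \<and> degree G = e" using assms A0 by blast
  from LeastI_ex[OF this] have "\<exists>G\<in>Q. G \<noteq> 0 \<and> degree G = e" by (simp add: e_def)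
  moreover have e_le: "e \<le> degree G" if "G \<in> Q" "G \<noteq> 0" for G
    unfolding e_def using that by (intro Least_le) auto
  \<comment> \<open>Among the nonzero elements of least outer degree, one with leading coefficient
    of least degree is taken, so that splitting off an inner linear factor would contradict
    minimality.\<close>
  define n where "n = (LEAST n. \<exists>G\<in>Q. G \<noteq> 0 \<and> degree G = e \<and> degree (lead_coeff G) = n)"
  ultimately have "\<exists>n. \<exists>G\<in>Q. G \<noteq> 0 \<and> degree G = e \<and> degree (lead_coeff G) = n" by blast
  from LeastI_ex[OF this] obtain F where F: "F \<in> Q" "F \<noteq> 0" "degree F = e" "degree (lead_coeff F) = n"
    unfolding n_def[symmetric] by blast
  have n_le: "n \<le> degree (lead_coeff G)" if "G \<in> Q" "G \<noteq> 0" "degree G = e" for G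
    unfolding n_def using that by (intro Least_le) auto
  \<comment> \<open>Pseudo-division leaves a remainder in \<open>Q\<close> of smaller outer degree
    than \<open>F\<close>, hence zero.\<close>
  have "\<exists>c. c \<noteq> 0 \<and> (\<exists>h. [:c:] * A = F * h)"
  proof -
    obtain h r where hr: "pseudo_divmod A F = (h, r)" by fastforce
    define c where "c = lead_coeff F ^ (Suc (degree A) - degree F)"
    have eq: "smult c A = F * h + r" and r: "r = 0 \<or> degree r < degree F"
      using pseudo_divmod[OF F(2) hr] by (simp_all add: c_def)
    have "r = [:c:] * A - h * F" using eq by (simp add: algebra_simps)
    then have "r \<in> Q" using diff mult assms(1) F(1) by metis
    then have "r = 0" using r e_le[of r] F(3) by linarith
    moreover have "c \<noteq> 0" using F(2) by (simp add: c_def)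
    ultimately show ?thesis using eq by auto
  qed
  then obtain c h where c: "c \<noteq> 0" "[:c:] * A = F * h"
    and c_min: "\<And>c' h'. c' \<noteq> 0 \<Longrightarrow> [:c':] * A = F * h' \<Longrightarrow> degree c \<le> degree c'"
  proof -
    assume *: "\<exists>c. c \<noteq> 0 \<and> (\<exists>h. [:c:] * A = F * h)"
      and that: "\<And>c h. c \<noteq> 0 \<Longrightarrow> [:c:] * A = F * h \<Longrightarrow>
        (\<And>c' h'. c' \<noteq> 0 \<Longrightarrow> [:c':] * A = F * h' \<Longrightarrow> degree c \<le> degree c') \<Longrightarrow> thesis"
    then show thesis
      using ex_has_least_nat[of "\<lambda>c. c \<noteq> 0 \<and> (\<exists>h. [:c:] * A = F * h)" _ degree] by metis
  qed
  \<comment> \<open>A root of \<open>c\<close> gives a linear prime dividing \<open>F\<close> or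
    \<open>h\<close>; dividing it out contradicts the minimality of \<open>n\<close> or of
    \<open>degree c\<close>.\<close>
  have "degree c = 0"
  proof (rule ccontr)
    assume "degree c \<noteq> 0"
    then obtain r where "poly c r = 0" using alg_closed_imp_poly_has_root[of c] by auto
    define p where "p = [:-r, 1:]"
    have p0: "p \<noteq> 0" "degree p = 1" by (simp_all add: p_def)
    obtain c' where c': "c = p * c'"
      using \<open>poly c r = 0\<close> unfolding poly_eq_0_iff_dvd p_def by (auto simp: dvd_def)
    have c'0: "c' \<noteq> 0" using c' c by auto
    have pc: "[:c:] = [:p:] * [:c':]" by (simp add: c')
    have "prime_elem [:p:]"
      unfolding p_def using prime_elem_linear by (rule lift_prime_elem_poly)
    moreover have "[:p:] dvd F * h" using c(2) unfolding pc by (metis dvd_triv_left mult.assoc)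
    ultimately consider "[:p:] dvd F" | "[:p:] dvd h" by (auto dest: prime_elem_dvd_multD)
    then show False
    proof cases
      case 1
      then obtain F' where F': "F = [:p:] * F'" by (auto simp: dvd_def)
      have "F' \<noteq> 0" using F' F by auto
      moreover have "F' \<in> Q" using F(1) F' prime_ideal const[of p] p0 by blast
      moreover have "degree F' = e" using F' F(3) p0 by simp
      ultimately have "n \<le> degree (lead_coeff F')" using n_le by blast
      moreover have "lead_coeff F = p * lead_coeff F'" using F' by (simp add: p0)
      then have "n = 1 + degree (lead_coeff F')"
        using F(4) \<open>F' \<noteq> 0\<close> p0 by (simp add: degree_mult_eq)
      ultimately show False by simp
    next
      case 2
      then obtain h' where h': "h = [:p:] * h'" by (auto simp: dvd_def)
      have "[:p:] * ([:c':] * A) = [:p:] * (F * h')"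
        using c(2) unfolding pc h' by (simp only: mult_ac)
      then have "[:c':] * A = F * h'" using p0 by (metis mult_left_cancel pCons_eq_0_iff)
      then have "degree c \<le> degree c'" using c_min c'0 by blast
      then show False using c' c'0 p0 by (simp add: degree_mult_eq)
    qed
  qed
  then obtain u where u: "c = [:u:]" "u \<noteq> 0" using c(1) by (metis degree_eq_zeroE pCons_eq_0_iff)
  \<comment> \<open>As \<open>A\<close> is monic, the constant \<open>c\<close> is the product of
    the leading coefficients of \<open>F\<close> and \<open>h\<close>, which are therefore
    constants.\<close>
  have "lead_coeff [:c:] * lead_coeff A = lead_coeff F * lead_coeff h"
    using c(2) by (metis lead_coeff_mult)
  then have "c = lead_coeff F * lead_coeff h" using assms(2) by simp
  then have "degree (lead_coeff F) = 0"
    using \<open>degree c = 0\<close> c(1) by (metis add_is_0 degree_mult_eq mult_eq_0_iff)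
  moreover have "A = F * ([:[:1 / u:]:] * h)"
  proof -
    have "F * ([:[:1 / u:]:] * h) = [:[:1 / u:]:] * ([:c:] * A)" using c(2) by (simp add: mult_ac)
    also have "\<dots> = A" using u by (simp add: one_pCons[symmetric])
    finally show ?thesis by simp
  qed
  ultimately show thesis using F e_le that by blast
qed

text \<open>Division by \<open>F\<close>: its leading coefficient is a nonzero scalar and its total
  degree does not exceed its outer degree, so cancelling a leading term never breaks the bound
  \<open>k\<close> on the total degree.\<close>

lemma reduce:
  assumes F: "F \<in> Q" "F \<noteq> 0" "degree (lead_coeff F) = 0" "tdeg_le (degree F) F"
  shows "tdeg_le k W \<Longrightarrow> \<exists>V. tdeg_le k V \<and> (V = 0 \<or> degree V < degree F) \<and> W - V \<in> Q"
proof (induction "degree W" arbitrary: W rule: less_induct)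
  case less
  show ?case
  proof (cases "W = 0 \<or> degree W < degree F")
    case True
    then show ?thesis using less.prems zero by (intro exI[of _ W]) auto
  next
    case False
    obtain u where u: "lead_coeff F = [:u:]" "u \<noteq> 0"
      using F by (metis degree_eq_zeroE leading_coeff_0_iff pCons_eq_0_iff)
    define n where "n = degree W"
    \<comment> \<open>Multiplying \<open>F\<close> by this term reproduces the leading term of
      \<open>W\<close>.\<close>
    define M where "M = monom (smult (1 / u) (lead_coeff W)) (n - degree F)"
    have nk: "n \<le> k" using tdeg_le_degree[OF less.prems] by (simp add: n_def)
    have "degree (lead_coeff W) \<le> k - n"
      using tdeg_le_degree_coeff[OF less.prems] by (simp add: n_def)
    then have "tdeg_le (k - degree F) M"
      unfolding M_def using False nk by (intro tdeg_le_monom) (auto simp: n_def)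
    then have "tdeg_le (k - degree F + degree F) (M * F)" using F(4) by (rule tdeg_le_mult)
    then have MF: "tdeg_le k (M * F)" using False nk by (simp add: n_def)
    let ?W = "W - M * F"
    have W: "tdeg_le k ?W" using less.prems MF by (rule tdeg_le_diff)
    have M0: "M \<noteq> 0" using False u by (simp add: M_def)
    have dM: "degree M = n - degree F"
      unfolding M_def using False u(2) by (intro degree_monom_eq) auto
    have degMF: "degree (M * F) = n"
      using degree_mult_eq[OF M0 F(2)] dM False by (simp add: n_def)
    have "lead_coeff (M * F) = lead_coeff W"
      unfolding lead_coeff_mult u(1) dM using u(2) by (simp add: M_def)
    then have "coeff ?W n = 0" using degMF by (simp add: n_def)
    moreover have "degree ?W \<le> n" using degMF by (intro degree_diff_le) (auto simp: n_def)
    ultimately have "degree ?W < n \<or> ?W = 0"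
      by (metis le_neq_implies_less leading_coeff_0_iff)
    moreover have "M * F \<in> Q" using F(1) by (rule mult)
    then have *: "W - V \<in> Q" if "?W - V \<in> Q" for V
    proof -
      have "W - V = (?W - V) - (0 - M * F)" by simp
      then show ?thesis using that diff zero \<open>M * F \<in> Q\<close> by metis
    qed
    ultimately show ?thesis
      using less.hyps[of ?W] W * zero unfolding n_def by (metis diff_zero diff_self tdeg_le_0)
  qed
qed

end

lemma tdeg_le_cancel_monom:
  assumes "tdeg_le (n + t) ([:monom 1 n:] * W)"
  shows "tdeg_le t W"
  unfolding tdeg_le_def
proof (intro allI impI)
  fix i j assume "coeff (coeff W i) j \<noteq> 0"
  then have "coeff (coeff ([:monom 1 n:] * W) i) (n + j) \<noteq> 0"
    by (simp add: coeff_monom_mult)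
  then show "i + j \<le> t" using assms unfolding tdeg_le_def by fastforce
qed

section \<open>Coordinates adapted to a projection\<close>

text \<open>A basis \<open>b\<close> of the ambient space with its dual coordinates
  \<open>a\<close>. The vector \<open>b 3\<close> will be the centre of projection and
  \<open>b 2\<close> the direction of the outer variable.\<close>

locale frame =
  fixes a b :: "4 \<Rightarrow> 'k::field ^ 4"
  assumes dual: "dot (a i) (b j) = (if i = j then 1 else 0)"
    and expand: "v = (\<Sum>i\<in>UNIV. dot (a i) v *s b i)"

lemma UNIV_4_explicit: "(UNIV :: 4 set) = {0, 1, 2, 3}"
  unfolding UNIV_4 by auto

lemma sum_UNIV_4: "(\<Sum>i\<in>UNIV. f (i :: 4)) = f 0 + f 1 + f 2 + f 3"
  unfolding UNIV_4_explicit by (simp add: add.assoc)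

text \<open>A basis extending \<open>P2\<close> and \<open>P\<close> is enumerated with these two
  last, and each dual covector separates one basis vector from the others.\<close>

lemma exists_frame:
  fixes P P2 :: "'k::field ^ 4"
  assumes "P \<noteq> 0" "P2 \<notin> vec.span {P}"
  obtains a b where "frame a b" "b 3 = P" "b 2 = P2"
proof -
  have ind: "vec.independent {P2, P}"
    using assms vec.independent_insertI[of P2 "{P}"] by simp
  obtain B where B: "{P2, P} \<subseteq> B" "vec.independent B" "UNIV \<subseteq> vec.span B"
    by (rule vec.maximal_independent_subset_extend[OF subset_UNIV ind])
  have fin: "finite B" using B(2) by (rule vec.finiteI_independent)
  have "card B = vec.dim (UNIV :: ('k ^ 4) set)"
    using B by (intro vec.basis_card_eq_dim) auto
  then have "card B = 4" by (simp add: vec.dim_UNIV card_cart_basis)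
  moreover have "P2 \<noteq> P" using assms(2) vec.span_base by blast
  ultimately have "card (B - {P2, P}) = 2"
    using B(1) fin by (simp add: card_Diff_subset)
  then obtain x y where xy: "B - {P2, P} = {x, y}" "x \<noteq> y" by (meson card_2_iff)
  define b where "b = (\<lambda>i::4. if i = 3 then P else if i = 2 then P2 else if i = 1 then x else y)"
  have "b 0 = y" "b 1 = x" "b 2 = P2" "b 3 = P" by (simp_all add: b_def)
  then have "range b = {y, x, P2, P}" unfolding UNIV_4_explicit by simp
  also have "\<dots> = B" using xy(1) B(1) by blast
  finally have rb: "range b = B" .
  have inj: "inj b"
    using rb \<open>card B = 4\<close> by (intro eq_card_imp_inj_on) simp_all
  have "\<exists>c. (\<forall>j. j \<noteq> i \<longrightarrow> dot c (b j) = 0) \<and> dot c (b i) = 1" for i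
  proof -
    have "b i \<notin> vec.span (B - {b i})"
      using B(2) rb by (auto simp: vec.dependent_def)
    then obtain c where "\<And>u. u \<in> B - {b i} \<Longrightarrow> dot c u = 0" "dot c (b i) = 1"
      using separating_covector by blast
    then show ?thesis using rb inj by (intro exI[of _ c]) (auto simp: inj_def)
  qed
  then obtain a where a: "\<And>i j. j \<noteq> i \<Longrightarrow> dot (a i) (b j) = 0" "\<And>i. dot (a i) (b i) = 1" by metis
  have dual: "dot (a i) (b j) = (if i = j then 1 else 0)" for i j using a by auto
  have "v = (\<Sum>i\<in>UNIV. dot (a i) v *s b i)" for v
  proof -
    have "v \<in> vec.span (b ` UNIV)" using B(3) rb by auto
    then obtain c where c: "v = (\<Sum>i\<in>UNIV. c i *s b i)"
      using vec.span_image_finite[of UNIV v b] by auto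
    have "dot (a i) v = c i" for i
      by (subst c) (simp add: dual if_distrib cong: if_cong)
    then show ?thesis using c by simp
  qed
  with dual have "frame a b" by unfold_locales
  moreover have "b 3 = P" "b 2 = P2" by (simp_all add: b_def)
  ultimately show thesis by (rule that)
qed

text \<open>Homogenization with the inner variable read as \<open>a 1 / a 0\<close> and the outer
  one as \<open>a 2 / a 0\<close>. As \<open>a 3\<close> is absent, the result is a cone with vertex
  \<open>b 3\<close> in a frame.\<close>

definition homogenize :: "(4 \<Rightarrow> 'k::comm_ring_1 ^ 4) \<Rightarrow> nat \<Rightarrow> 'k poly poly \<Rightarrow> 'k poly4" where
  "homogenize a t W = (\<Sum>i\<le>t. \<Sum>j\<le>t - i. scale4 (coeff (coeff W i) j)
     (linear_form (a 0) ^ (t - i - j) * linear_form (a 1) ^ j * linear_form (a 2) ^ i))"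

lemma homogenize_forms: "homogenize a t W \<in> forms t"
  unfolding homogenize_def
proof (intro forms_sum forms_scale4)
  fix i j assume "i \<in> {..t}" "j \<in> {..t - i}"
  then have "t - i - j + j + i = t" by auto
  then show "linear_form (a 0) ^ (t - i - j) * linear_form (a 1) ^ j * linear_form (a 2) ^ i \<in> forms t"
    using forms_mult[OF forms_mult[OF linear_form_power_forms linear_form_power_forms]
        linear_form_power_forms, of "a 0" "t - i - j" "a 1" j "a 2" i] by simp
qed

lemma eval4_homogenize:
  fixes a :: "4 \<Rightarrow> 'k::field ^ 4"
  assumes "tdeg_le t W" "dot (a 0) v \<noteq> 0"
  shows "eval4 (homogenize a t W) v =
    dot (a 0) v ^ t * eval2 W (dot (a 1) v / dot (a 0) v) (dot (a 2) v / dot (a 0) v)"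
proof -
  have pow: "l0 ^ (t - i - j) * l1 ^ j * l2 ^ i = l0 ^ t * ((l1 / l0) ^ j * (l2 / l0) ^ i)"
    if "i \<le> t" "j \<le> t - i" "l0 \<noteq> 0" for l0 l1 l2 :: 'k and i j
  proof -
    have "t = (t - i - j) + j + i" using that by simp
    then have "l0 ^ t = l0 ^ (t - i - j) * l0 ^ j * l0 ^ i" by (metis power_add)
    then show ?thesis using that(3) by (simp add: power_divide field_simps)
  qed
  show ?thesis
    unfolding homogenize_def eval2_expand[OF assms(1)] eval4_sum sum_distrib_left
    using pow[OF _ _ assms(2)]
    by (intro sum.cong) (simp_all add: mult.assoc mult.left_commute)
qed

text \<open>The pullback of \<open>F\<close> to the affine plane of points
  \<open>b 0 + s b 1 + x b 2\<close>.\<close>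

definition restrict_plane :: "(4 \<Rightarrow> 'k::comm_ring_1 ^ 4) \<Rightarrow> 'k poly4 \<Rightarrow> 'k poly poly" where
  "restrict_plane b F = (\<Sum>c\<in>Poly_Mapping.keys F. [:[:Poly_Mapping.lookup F c:]:] *
     (\<Prod>i\<in>UNIV. [:[:b 0 $ i, b 1 $ i:], [:b 2 $ i:]:] ^ Poly_Mapping.lookup c i))"

lemma eval2_restrict_plane:
  "eval2 (restrict_plane b F) s x = eval4 F (b 0 + s *s b 1 + x *s b 2)"
proof -
  have "eval2 [:[:b 0 $ i, b 1 $ i:], [:b 2 $ i:]:] s x = (b 0 + s *s b 1 + x *s b 2) $ i" for i
    by (simp add: eval2_def)
  then show ?thesis by (simp add: restrict_plane_def eval4_def)
qed

lemma tdeg_le_restrict_plane: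
  assumes "F \<in> forms t"
  shows "tdeg_le t (restrict_plane b F)"
  unfolding restrict_plane_def
proof (rule tdeg_le_sum)
  fix c assume "c \<in> Poly_Mapping.keys F"
  then have "(\<Sum>i\<in>UNIV. 1 * Poly_Mapping.lookup c i) = t"
    using assms by (simp add: forms_def monom_degree_def)
  moreover have "tdeg_le 1 [:[:b 0 $ i, b 1 $ i:], [:b 2 $ i:]:]" for i
    by (auto simp: tdeg_le_def coeff_pCons split: nat.splits)
  then have "tdeg_le (\<Sum>i\<in>UNIV. 1 * Poly_Mapping.lookup c i)
      (\<Prod>i\<in>UNIV. [:[:b 0 $ i, b 1 $ i:], [:b 2 $ i:]:] ^ Poly_Mapping.lookup c i)"
    by (intro tdeg_le_prod tdeg_le_power)
  ultimately show "tdeg_le t ([:[:Poly_Mapping.lookup F c:]:] *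
      (\<Prod>i\<in>UNIV. [:[:b 0 $ i, b 1 $ i:], [:b 2 $ i:]:] ^ Poly_Mapping.lookup c i))"
    using tdeg_le_mult[OF tdeg_le_const] by fastforce
qed

lemma prod_const_poly: "(\<Prod>x\<in>A. [:f x:]) = [:\<Prod>x\<in>A. f x:]"
  by (induction A rule: infinite_finite_induct) (simp_all add: one_pCons mult.commute)

lemma sum_const_poly: "(\<Sum>x\<in>A. [:f x:]) = [:\<Sum>x\<in>A. f x:]"
  by (induction A rule: infinite_finite_induct) simp_all

text \<open>The top power of the outer variable arises by taking the part along \<open>b 2\<close>
  in every factor, so its coefficient is a scalar, nonzero as soon as \<open>F\<close> does not
  vanish at \<open>b 2\<close>.\<close>

lemma coeff_restrict_plane:
  assumes "F \<in> forms t"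
  shows "coeff (restrict_plane b F) t = [:eval4 F (b 2):]"
proof -
  have "coeff (\<Prod>i\<in>UNIV. [:[:b 0 $ i, b 1 $ i:], [:b 2 $ i:]:] ^ Poly_Mapping.lookup c i) t
      = [:monom_val (b 2) c:]" if "c \<in> Poly_Mapping.keys F" for c
  proof -
    let ?X = "\<lambda>i. [:[:b 0 $ i, b 1 $ i:], [:b 2 $ i:]:]"
    have t: "t = (\<Sum>i\<in>UNIV. 1 * Poly_Mapping.lookup c i)"
      using assms that by (simp add: forms_def monom_degree_def)
    have deg: "degree (?X i) \<le> 1" for i by simp
    have "coeff (\<Prod>i\<in>UNIV. ?X i ^ Poly_Mapping.lookup c i) t =
        (\<Prod>i\<in>UNIV. coeff (?X i ^ Poly_Mapping.lookup c i) (1 * Poly_Mapping.lookup c i))"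
      unfolding t using order.trans[OF degree_power_le mult_le_mono1[OF deg]]
      by (intro coeff_prod_top) auto
    also have "\<dots> = (\<Prod>i\<in>UNIV. [:b 2 $ i:] ^ Poly_Mapping.lookup c i)"
      unfolding coeff_power_top[OF deg] by simp
    also have "\<dots> = [:monom_val (b 2) c:]"
      by (simp add: poly_const_pow prod_const_poly)
    finally show ?thesis .
  qed
  then show ?thesis
    by (simp add: restrict_plane_def coeff_sum eval4_def sum_const_poly mult.commute)
qed

text \<open>Up to a multiple of \<open>b 3\<close>, which does not change \<open>F\<close>, the
  vector \<open>v\<close> is a multiple of a point of the affine plane.\<close>

lemma (in frame) translation_invariant_eval:
  assumes "F \<in> forms t" "\<And>v c. eval4 F (v + c *s b 3) = eval4 F v" "dot (a 0) v \<noteq> 0"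
  shows "dot (a 0) v ^ t * eval2 (restrict_plane b F) (dot (a 1) v / dot (a 0) v) (dot (a 2) v / dot (a 0) v)
    = eval4 F v"
proof -
  let ?w = "b 0 + (dot (a 1) v / dot (a 0) v) *s b 1 + (dot (a 2) v / dot (a 0) v) *s b 2"
  have "v = dot (a 0) v *s ?w + dot (a 3) v *s b 3"
    using assms(3) by (subst expand[of v], subst sum_UNIV_4) (simp add: vec.scale_right_distrib)
  then have "eval4 F v = eval4 F (dot (a 0) v *s ?w)" using assms(2) by metis
  then show ?thesis by (simp add: eval4_forms_scale[OF assms(1)] eval2_restrict_plane)
qed

lemma (in frame) homogenize_translation_invariant:
  "eval4 (homogenize a t W) (v + c *s b 3) = eval4 (homogenize a t W) v"
  by (simp add: homogenize_def dual)

lemma (in frame) homogenize_nonzero: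
  fixes W :: "'k poly poly"
  assumes "tdeg_le t W" "eval2 W s x \<noteq> 0"
  shows "eval4 (homogenize a t W) (b 0 + s *s b 1 + x *s b 2) \<noteq> 0"
  using assms(2) eval4_homogenize[OF assms(1), of a "b 0 + s *s b 1 + x *s b 2"] by (simp add: dual)

locale curve_frame = space_curve C d + frame a b
  for C :: "('k::{alg_closed_field, field_char_0} ^ 4) set set" and d and a b :: "4 \<Rightarrow> 'k ^ 4"
begin

abbreviation "l i v \<equiv> dot (a i) v"

text \<open>The ideal of the image of \<open>C\<close> under projection from \<open>b 3\<close>, in
  the affine chart \<open>l 0 \<noteq> 0\<close>.\<close>

definition Q :: "'k poly poly set" where
  "Q = {W. \<forall>v\<in>\<Union>C. l 0 v \<noteq> 0 \<longrightarrow> eval2 W (l 1 v / l 0 v) (l 2 v / l 0 v) = 0}"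

lemma Q_D: "W \<in> Q \<Longrightarrow> v \<in> \<Union>C \<Longrightarrow> l 0 v \<noteq> 0 \<Longrightarrow> eval2 W (l 1 v / l 0 v) (l 2 v / l 0 v) = 0"
  unfolding Q_def by blast

lemma Q_I: "(\<And>v. v \<in> \<Union>C \<Longrightarrow> l 0 v \<noteq> 0 \<Longrightarrow> eval2 W (l 1 v / l 0 v) (l 2 v / l 0 v) = 0) \<Longrightarrow> W \<in> Q"
  unfolding Q_def by blast

lemma ideal_I: "(\<And>v. v \<in> \<Union>C \<Longrightarrow> eval4 F v = 0) \<Longrightarrow> F \<in> I"
  unfolding mem_vanishing_ideal_iff by blast

lemma covector_nonzero: "a i \<noteq> 0"
proof
  assume "a i = 0"
  then have "dot (a i) (b i) = 0" by simp
  then show False by (simp add: dual)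
qed

text \<open>The product with \<open>linear_form (a 0)\<close> vanishes on all of \<open>C\<close>,
  and that factor lies outside the prime ideal by non-degeneracy.\<close>

lemma mem_ideal_off_hyperplane:
  assumes "F \<in> forms t" "\<And>v. v \<in> \<Union>C \<Longrightarrow> l 0 v \<noteq> 0 \<Longrightarrow> eval4 F v = 0"
  shows "F \<in> I"
proof -
  have "linear_form (a 0) * F \<in> I"
    using assms(2) by (intro ideal_I) auto
  then show ?thesis
    using prime[OF linear_form_forms assms(1)] linear_form_notin_ideal[OF covector_nonzero] by blast
qed

lemma homogenize_in_ideal_iff:
  assumes "tdeg_le t W"
  shows "homogenize a t W \<in> I \<longleftrightarrow> W \<in> Q"
proof
  assume W: "homogenize a t W \<in> I"
  show "W \<in> Q"
  proof (rule Q_I)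
    fix v assume v: "v \<in> \<Union>C" "l 0 v \<noteq> 0"
    show "eval2 W (l 1 v / l 0 v) (l 2 v / l 0 v) = 0"
      using vanishing_idealD[OF W v(1)] eval4_homogenize[OF assms, of a v] v(2) by simp
  qed
next
  assume "W \<in> Q"
  then show "homogenize a t W \<in> I"
    using Q_D[of W] eval4_homogenize[OF assms, of a]
    by (intro mem_ideal_off_hyperplane[OF homogenize_forms]) auto
qed

lemma point_off_hyperplane:
  obtains v where "v \<in> \<Union>C" "l 0 v \<noteq> 0"
  using linear_form_notin_ideal[OF covector_nonzero[of 0]] ideal_I[of "linear_form (a 0)"] by auto

sublocale prime_plane_ideal Q
proof
  show "0 \<in> Q" by (rule Q_I) simp
  show "W - V \<in> Q" if "W \<in> Q" "V \<in> Q" for W V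
    using Q_D[OF that(1)] Q_D[OF that(2)] by (intro Q_I) simp
  show "V * W \<in> Q" if "W \<in> Q" for W V
    using Q_D[OF that] by (intro Q_I) simp
  \<comment> \<open>Primality is inherited from the ideal of \<open>C\<close> through
    homogenization.\<close>
  show Q_prime: "W \<in> Q \<or> V \<in> Q" if WV: "W * V \<in> Q" for W V
  proof -
    obtain t u where tu: "tdeg_le t W" "tdeg_le u V" using exists_tdeg_le by metis
    have "homogenize a t W * homogenize a u V \<in> I"
      using Q_D[OF WV] eval4_homogenize[OF tu(1), of a] eval4_homogenize[OF tu(2), of a]
      by (intro mem_ideal_off_hyperplane[OF forms_mult[OF homogenize_forms homogenize_forms]]) auto
    then show ?thesis
      using prime[OF homogenize_forms homogenize_forms]
        homogenize_in_ideal_iff[OF tu(1)] homogenize_in_ideal_iff[OF tu(2)] by blast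
  qed
  \<comment> \<open>Roots of \<open>c\<close> are divided out by induction on the degree: a linear
    factor in \<open>Q\<close> would put \<open>C\<close> into the plane
    \<open>l 1 = r * l 0\<close>.\<close>
  show "c = 0" if "[:c:] \<in> Q" for c
    using that
  proof (induction "degree c" arbitrary: c rule: less_induct)
    case less
    obtain v where v: "v \<in> \<Union>C" "l 0 v \<noteq> 0" by (rule point_off_hyperplane)
    show ?case
    proof (cases "degree c = 0")
      case True
      then obtain u where u: "c = [:u:]" by (rule degree_eq_zeroE)
      then show ?thesis using Q_D[OF less.prems v] by simp
    next
      case False
      then obtain r where "poly c r = 0" using alg_closed_imp_poly_has_root[of c] by auto
      then obtain c' where c': "c = [:-r, 1:] * c'"
        unfolding poly_eq_0_iff_dvd by (auto simp: dvd_def)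
      have "[:[:-r, 1:]:] \<notin> Q"
      proof
        assume r: "[:[:-r, 1:]:] \<in> Q"
        have "linear_form (a 1 - r *s a 0) \<in> I"
        proof (rule mem_ideal_off_hyperplane[OF linear_form_forms])
          fix v assume v: "v \<in> \<Union>C" "l 0 v \<noteq> 0"
          then have "l 1 v / l 0 v - r = 0" using Q_D[OF r v] by simp
          then show "eval4 (linear_form (a 1 - r *s a 0)) v = 0" using v(2) by (simp add: field_simps)
        qed
        then have "a 1 - r *s a 0 = 0" using linear_form_notin_ideal by blast
        then have "dot (a 1 - r *s a 0) (b 1) = 0" by simp
        then show False by (simp add: dual)
      qed
      moreover have "[:c:] = [:[:-r, 1:]:] * [:c':]" by (simp add: c')
      ultimately have "[:c':] \<in> Q" using Q_prime less.prems by metis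
      moreover have "degree c' < degree c \<or> c' = 0"
        unfolding c' by (cases "c' = 0") (auto simp: degree_mult_eq simp del: mult_pCons_left)
      ultimately have "c' = 0" using less.hyps by blast
      then show ?thesis using c' by simp
    qed
  qed
qed

text \<open>There are more monomials of degree at most \<open>d\<close> in the last variable than the linear
  growth of the Hilbert function of \<open>C\<close> allows.\<close>

lemma exists_cone:
  obtains t W where "t > 0" "W \<noteq> 0" "tdeg_le t W" "degree W \<le> d" "W \<in> Q"
proof -
  obtain t0 c where hf: "\<And>t. t \<ge> t0 \<Longrightarrow> int (hilbert_function I t) = int d * int t + c"
    using hilbert_linear by blast
  \<comment> \<open>\<open>(d + 1) * (t - d + 1)\<close> exceeds \<open>d * t + c\<close> once
    \<open>t \<ge> c + (d + 1) * d + 1\<close>; the other summands ensure \<open>t \<ge> t0\<close>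
    and \<open>t \<ge> d\<close>, and \<open>nat c\<close> copes with a negative
    \<open>c\<close>.\<close>
  define t where "t = t0 + d + nat c + (d + 1) * d + 1"
  \<comment> \<open>First components are exponents of the outer variable, so a relation has outer
    degree at most \<open>d\<close>; the two exponents together stay within
    \<open>t\<close>.\<close>
  define J where "J = {..d} \<times> {..t - d}"
  define f where "f = (\<lambda>(i, j). linear_form (a 0) ^ (t - i - j) * linear_form (a 1) ^ j * linear_form (a 2) ^ i)"
  have dt: "d \<le> t" by (simp add: t_def)
  have J: "i + j \<le> t" if "(i, j) \<in> J" for i j using that dt by (auto simp: J_def)
  have f: "f ` J \<subseteq> forms t"
  proof
    fix x assume "x \<in> f ` J"
    then obtain i j where ij: "(i, j) \<in> J" "x = f (i, j)" by auto
    then have "t - i - j + j + i = t" using J by fastforce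
    then show "x \<in> forms t"
      using forms_mult[OF forms_mult[OF linear_form_power_forms linear_form_power_forms]
        linear_form_power_forms, of "a 0" "t - i - j" "a 1" j "a 2" i] ij(2) by (simp add: f_def)
  qed
  have "int (hilbert_function I t) < int (card J)"
  proof -
    have "card J = (d + 1) * (t - d + 1)" by (simp add: J_def)
    then have "int (card J) = (int d + 1) * (int t - int d + 1)"
      using dt by (simp only: of_nat_mult of_nat_add of_nat_diff of_nat_1)
    moreover have "int t \<ge> c + (int d + 1) * int d + 1"
      unfolding t_def of_nat_add of_nat_mult of_nat_1 by linarith
    moreover have "int (hilbert_function I t) = int d * int t + c" by (intro hf) (simp add: t_def)
    ultimately show ?thesis by (simp add: algebra_simps)
  qed
  moreover have "finite J" by (simp add: J_def)
  ultimately have "\<not> indep_mod_ideal C J f"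
    using indep_card_le_hilbert[OF \<open>finite J\<close> f, of C] by linarith
  then obtain e i0 j0 where e: "(\<Sum>x\<in>J. scale4 (e x) (f x)) \<in> I" "(i0, j0) \<in> J" "e (i0, j0) \<noteq> 0"
    unfolding poly4.indep_family_mod_def by auto
  \<comment> \<open>The linear relation between the monomials, dehomogenized.\<close>
  define W where "W = (\<Sum>(i, j)\<in>J. monom (monom (e (i, j)) j) i)"
  have coeff_W: "coeff (coeff W i) j = (if (i, j) \<in> J then e (i, j) else 0)" for i j
  proof -
    have "coeff (coeff W i) j = (\<Sum>x\<in>J. if x = (i, j) then e x else 0)"
      unfolding W_def coeff_sum by (intro sum.cong) (auto simp: coeff_monom split: if_splits)
    then show ?thesis by (simp add: J_def)
  qed
  have W0: "W \<noteq> 0" using coeff_W[of i0 j0] e by auto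
  have tW: "tdeg_le t W"
    unfolding tdeg_le_def using J coeff_W by (auto split: if_splits)
  have "coeff W i = 0" if "i > d" for i
    using that by (intro poly_eqI) (simp add: coeff_W J_def)
  then have degW: "degree W \<le> d" by (intro degree_le) auto
  have "homogenize a t W = (\<Sum>(i, j)\<in>(SIGMA i:{..t}. {..t - i}).
      scale4 (coeff (coeff W i) j) (f (i, j)))"
    unfolding homogenize_def f_def by (subst sum.Sigma) auto
  also have "\<dots> = (\<Sum>(i, j)\<in>J. scale4 (coeff (coeff W i) j) (f (i, j)))"
    using J coeff_W by (intro sum.mono_neutral_right) (fastforce simp: scale4_def split: if_splits)+
  also have "\<dots> = (\<Sum>x\<in>J. scale4 (e x) (f x))"
    by (intro sum.cong) (auto simp: coeff_W)
  finally have "homogenize a t W \<in> I" using e(1) by simp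
  then have "W \<in> Q" using homogenize_in_ideal_iff[OF tW] by blast
  moreover have "t > 0" by (simp add: t_def)
  ultimately show thesis using W0 tW degW that by blast
qed

end

section \<open>The plane curve below a projection\<close>

context space_curve
begin

text \<open>The frame is chosen twice: the first yields a cone \<open>F\<close> through
  \<open>C\<close> with vertex \<open>P\<close>, the second takes a point off that cone as
  \<open>b 2\<close>, which makes the rescaled restriction of \<open>F\<close> monic in the outer
  variable.\<close>

lemma exists_monic_frame:
  assumes "P \<noteq> 0"
  obtains a b A t where "frame a b" "b 3 = P" "A \<in> curve_frame.Q C a" "lead_coeff A = 1"
    "degree A = t" "tdeg_le t A"
proof -
  have "vec.dim (vec.span {P}) \<le> 1" using vec.dim_le_card[of "{P}" "{P}"] vec.span_base by auto
  moreover have "vec.dim (UNIV :: ('k ^ 4) set) = 4" by (simp add: vec.dim_UNIV card_cart_basis)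
  ultimately have "vec.span {P} \<noteq> UNIV" by (metis numeral_le_one_iff semiring_norm(69))
  then obtain P' where "P' \<notin> vec.span {P}" by blast
  then obtain a' b' where f': "frame a' b'" "b' 3 = P" using exists_frame[OF assms] by metis
  interpret f': frame a' b' by (rule f'(1))
  interpret cf': curve_frame C d a' b' by unfold_locales
  obtain t W where W: "t > 0" "W \<noteq> 0" "tdeg_le t W" "W \<in> cf'.Q"
    by (rule cf'.exists_cone)
  define F where "F = homogenize a' t W"
  have F: "F \<in> forms t" "F \<in> I"
    unfolding F_def using homogenize_forms cf'.homogenize_in_ideal_iff[OF W(3)] W(4) by blast+
  have F_inv: "eval4 F (v + c *s P) = eval4 F v" for v c
    using f'.homogenize_translation_invariant[of t W v c] f'(2) by (simp add: F_def)
  obtain s x where "eval2 W s x \<noteq> 0" using W(2) by (rule exists_eval2_nonzero)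
  then obtain P2 where P2: "eval4 F P2 \<noteq> 0"
    using f'.homogenize_nonzero[OF W(3)] unfolding F_def by blast
  \<comment> \<open>On the line through \<open>P\<close> the cone is constant, hence zero since its
    degree is positive.\<close>
  have "P2 \<notin> vec.span {P}"
  proof
    assume "P2 \<in> vec.span {P}"
    then obtain c where "P2 = 0 *s P + c *s P" by (auto simp: mem_span_single)
    then have "eval4 F P2 = eval4 F (0 *s P)" using F_inv by metis
    also have "\<dots> = 0" using W(1) by (subst eval4_forms_scale[OF F(1)]) simp
    finally show False using P2 by blast
  qed
  then obtain a b where f: "frame a b" "b 3 = P" "b 2 = P2" using exists_frame[OF assms] by metis
  interpret f: frame a b by (rule f(1))
  interpret cf: curve_frame C d a b by unfold_locales
  define A where "A = [:[:1 / eval4 F P2:]:] * restrict_plane b F"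
  have tA: "tdeg_le t A"
    unfolding A_def using tdeg_le_mult[OF tdeg_le_const tdeg_le_restrict_plane[OF F(1)]] by simp
  have cA: "coeff A t = 1"
    using P2 f(3) by (simp add: A_def coeff_restrict_plane[OF F(1)] one_pCons)
  then have dA: "degree A = t"
    using tdeg_le_degree[OF tA] le_degree[of A t] by auto
  have "A \<in> cf.Q"
  proof (rule cf.Q_I)
    fix v assume v: "v \<in> \<Union>C" "dot (a 0) v \<noteq> 0"
    have "dot (a 0) v ^ t * eval2 (restrict_plane b F) (dot (a 1) v / dot (a 0) v) (dot (a 2) v / dot (a 0) v) = 0"
      using f.translation_invariant_eval[OF F(1) _ v(2)] F_inv f(2) vanishing_idealD[OF F(2) v(1)] by simp
    then show "eval2 A (dot (a 1) v / dot (a 0) v) (dot (a 2) v / dot (a 0) v) = 0"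
      using v(2) by (simp add: A_def)
  qed
  then show thesis using that f cA dA tA by metis
qed

text \<open>The generator \<open>F\<close> divides the monic \<open>A\<close>, whose total and outer
  degrees agree. Both degrees are additive, so they agree for \<open>F\<close> as well; the bound by
  \<open>d\<close> comes from \<open>exists_cone\<close> in the new frame.\<close>

lemma exists_plane_curve:
  assumes "P \<noteq> 0"
  obtains a b F where "frame a b" "b 3 = P" "F \<in> curve_frame.Q C a" "F \<noteq> 0"
    "\<And>G. G \<in> curve_frame.Q C a \<Longrightarrow> G \<noteq> 0 \<Longrightarrow> degree F \<le> degree G"
    "degree (lead_coeff F) = 0" "tdeg_le (degree F) F" "degree F \<le> d"
proof -
  obtain a b A t where f: "frame a b" "b 3 = P" and A: "A \<in> curve_frame.Q C a" "lead_coeff A = 1"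
    "degree A = t" "tdeg_le t A"
    by (rule exists_monic_frame[OF assms])
  interpret f: frame a b by (rule f(1))
  interpret cf: curve_frame C d a b by unfold_locales
  obtain F h where F: "F \<in> cf.Q" "F \<noteq> 0" "\<And>G. G \<in> cf.Q \<Longrightarrow> G \<noteq> 0 \<Longrightarrow> degree F \<le> degree G"
    "degree (lead_coeff F) = 0" "A = F * h"
    by (rule cf.monic_generator[OF A(1,2)]) (rule that; assumption)
  have "A \<noteq> 0" using A(2) by auto
  then have h0: "h \<noteq> 0" using F(5) by auto
  obtain u where u: "u \<le> t" "tdeg_le u h" "tdeg_le (t - u) F"
    using tdeg_le_factor[of t F h] A(4) \<open>A \<noteq> 0\<close> F(5) by auto
  \<comment> \<open>The outer degrees add up to \<open>t\<close> and are bounded by the total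
    degrees \<open>t - u\<close> and \<open>u\<close>, so equality holds in both bounds.\<close>
  have "degree F + degree h = t" using degree_mult_eq[OF F(2) h0] F(5) A(3) by simp
  then have "degree F = t - u" using tdeg_le_degree[OF u(2)] tdeg_le_degree[OF u(3)] u(1) by linarith
  then have "tdeg_le (degree F) F" using u(3) by simp
  moreover obtain W where "W \<noteq> 0" "degree W \<le> d" "W \<in> cf.Q"
    using cf.exists_cone by metis
  then have "degree F \<le> d" using F(3)[of W] by simp
  ultimately show thesis using that f F by metis
qed

text \<open>By \<open>inv\<close> the two differences are cones with vertex \<open>b 3\<close>, and
  on \<open>C\<close> they agree with \<open>l 3 * l i ^ (k - 1)\<close>. Reduction modulo
  \<open>F\<close> turns the resulting relation on \<open>C\<close> into an identity of polynomials,
  by which \<open>l 3\<close> is linear in the other coordinates on \<open>C\<close>, against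
  non-degeneracy.\<close>

lemma not_both_powers_in_image:
  assumes "frame a b" "F \<in> curve_frame.Q C a" "F \<noteq> 0"
    "\<And>G. G \<in> curve_frame.Q C a \<Longrightarrow> G \<noteq> 0 \<Longrightarrow> degree F \<le> degree G"
    "degree (lead_coeff F) = 0" "tdeg_le (degree F) F" "k > 0"
    and \<Phi>: "\<And>i. i = 0 \<or> i = 1 \<Longrightarrow> \<Phi> i \<in> forms k" "\<And>i. i = 0 \<or> i = 1 \<Longrightarrow> \<Phi> i \<in> I"
    and inv: "\<And>i v c. i = 0 \<or> i = 1 \<Longrightarrow>
      eval4 (linear_form (a 3) * linear_form (a i) ^ (k - 1) - \<Phi> i) (v + c *s b 3) =
      eval4 (linear_form (a 3) * linear_form (a i) ^ (k - 1) - \<Phi> i) v"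
  shows False
proof -
  interpret f: frame a b by (rule assms(1))
  interpret cf: curve_frame C d a b by unfold_locales
  define \<Psi> where "\<Psi> i = linear_form (a 3) * linear_form (a i) ^ (k - 1) - \<Phi> i" for i
  have \<Psi>: "\<Psi> i \<in> forms k" if "i = 0 \<or> i = 1" for i
    unfolding \<Psi>_def
    using forms_mult[OF linear_form_forms linear_form_power_forms, of "a 3" "a i" "k - 1"] assms(7) \<Phi>(1) that
    by (intro forms_diff) auto
  \<comment> \<open>On the projected curve the restricted cone equals \<open>l 3 / l 0\<close> times
    the power \<open>k - 1\<close> of \<open>l i / l 0\<close>.\<close>
  have ev: "eval2 (restrict_plane b (\<Psi> i)) (cf.l 1 v / cf.l 0 v) (cf.l 2 v / cf.l 0 v) =
      cf.l 3 v * cf.l i v ^ (k - 1) / cf.l 0 v ^ k"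
    if i: "i = 0 \<or> i = 1" and v: "v \<in> \<Union>C" "cf.l 0 v \<noteq> 0" for i v
  proof -
    have "cf.l 0 v ^ k * eval2 (restrict_plane b (\<Psi> i)) (cf.l 1 v / cf.l 0 v) (cf.l 2 v / cf.l 0 v)
        = eval4 (\<Psi> i) v"
      using inv[OF i] by (intro f.translation_invariant_eval \<Psi> i v) (simp add: \<Psi>_def)
    also have "\<dots> = cf.l 3 v * cf.l i v ^ (k - 1)"
      using vanishing_idealD[OF \<Phi>(2)[OF i] v(1)] by (simp add: \<Psi>_def)
    finally show ?thesis using v(2) by (simp add: field_simps)
  qed
  have "\<forall>i\<in>{0, 1}. \<exists>V. tdeg_le k V \<and> (V = 0 \<or> degree V < degree F) \<and>
      restrict_plane b (\<Psi> i) - V \<in> cf.Q"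
    using assms by (intro ballI cf.reduce tdeg_le_restrict_plane \<Psi>) auto
  then obtain V where "\<forall>i\<in>{0, 1}. tdeg_le k (V i) \<and> (V i = 0 \<or> degree (V i) < degree F) \<and>
      restrict_plane b (\<Psi> i) - V i \<in> cf.Q"
    by (rule bchoice[THEN exE])
  then have V: "\<And>i. i = 0 \<or> i = 1 \<Longrightarrow> tdeg_le k (V i)"
    "\<And>i. i = 0 \<or> i = 1 \<Longrightarrow> V i = 0 \<or> degree (V i) < degree F"
    "\<And>i. i = 0 \<or> i = 1 \<Longrightarrow> restrict_plane b (\<Psi> i) - V i \<in> cf.Q"
    by blast+
  have evV: "eval2 (V i) (cf.l 1 v / cf.l 0 v) (cf.l 2 v / cf.l 0 v) =
      cf.l 3 v * cf.l i v ^ (k - 1) / cf.l 0 v ^ k"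
    if i: "i = 0 \<or> i = 1" and v: "v \<in> \<Union>C" "cf.l 0 v \<noteq> 0" for i v
    using ev[OF i v] cf.Q_D[OF V(3)[OF i] v] by simp
  have pow: "x ^ k = x * x ^ (k - 1)" for x :: 'k using assms(7) by (cases k) auto
  \<comment> \<open>On the projected curve \<open>V 0\<close> equals \<open>l 3 / l 0\<close> and
    \<open>V 1\<close> is that times the power \<open>k - 1\<close> of the inner coordinate, so this
    difference vanishes there. The factor has no outer variable, which keeps the outer degree below
    \<open>degree F\<close>.\<close>
  define D where "D = [:monom 1 (k - 1):] * V 0 - V 1"
  have "D \<in> cf.Q"
  proof (rule cf.Q_I)
    fix v assume v: "v \<in> \<Union>C" "cf.l 0 v \<noteq> 0"
    show "eval2 D (cf.l 1 v / cf.l 0 v) (cf.l 2 v / cf.l 0 v) = 0"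
      using evV[OF _ v, of 0] evV[OF _ v, of 1] v(2)
      by (simp add: D_def poly_monom pow power_divide)
  qed
  moreover have "D = 0 \<or> degree D < degree F"
  proof (rule ccontr)
    assume "\<not> ?thesis"
    then have *: "D \<noteq> 0" "degree D \<ge> degree F" by auto
    then obtain n where n: "n \<ge> degree F" "coeff D n \<noteq> 0" by (metis leading_coeff_0_iff)
    have "coeff (V i) n = 0" if "i = 0 \<or> i = 1" for i
      using V(2)[OF that] n(1) by (auto intro: coeff_eq_0)
    then have "coeff D n = 0" by (simp add: D_def)
    then show False using n(2) by blast
  qed
  ultimately have "D = 0" using assms(4)[of D] by force
  then have "[:monom 1 (k - 1):] * V 0 = V 1" by (simp add: D_def)
  \<comment> \<open>\<open>V 1\<close> has total degree at most \<open>k\<close>, so removing the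
    inner power \<open>k - 1\<close> leaves total degree at most 1.\<close>
  then have "tdeg_le ((k - 1) + 1) ([:monom 1 (k - 1):] * V 0)" using V(1) assms(7) by simp
  then have V1: "tdeg_le 1 (V 0)" by (rule tdeg_le_cancel_monom)
  let ?c = "\<lambda>i j. coeff (coeff (V 0) i) j"
  \<comment> \<open>Cleared of denominators, \<open>l 3 / l 0 = V 0\<close> on \<open>C\<close> is
    the equation of a plane; the coefficient 1 of \<open>a 3\<close> makes it nontrivial.\<close>
  let ?n = "a 3 - ?c 0 0 *s a 0 - ?c 0 1 *s a 1 - ?c 1 0 *s a 2"
  have "linear_form ?n \<in> I"
  proof (rule cf.mem_ideal_off_hyperplane[OF linear_form_forms])
    fix v assume v: "v \<in> \<Union>C" "cf.l 0 v \<noteq> 0"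
    have "cf.l 3 v / cf.l 0 v = ?c 0 0 + ?c 0 1 * (cf.l 1 v / cf.l 0 v) + ?c 1 0 * (cf.l 2 v / cf.l 0 v)"
      using evV[OF _ v, of 0] v(2) unfolding eval2_expand[OF V1] by (simp add: pow)
    then show "eval4 (linear_form ?n) v = 0" using v(2) by (simp add: field_simps)
  qed
  then have "?n = 0" using linear_form_notin_ideal by blast
  then have "dot ?n (b 3) = 0" by (metis dot_0(2))
  then show False by (simp add: f.dual)
qed

end

section \<open>Directional derivatives\<close>

abbreviation (input) e4 :: "4 \<Rightarrow> monom4" where "e4 i \<equiv> Poly_Mapping.single i 1"

text \<open>Where the variable is missing the exponent factor is 0, so the truncated subtraction
  does no harm.\<close>

definition pdiff :: "4 \<Rightarrow> 'k::comm_ring_1 poly4 \<Rightarrow> 'k poly4" where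
  "pdiff i F = (\<Sum>a\<in>Poly_Mapping.keys F.
     Poly_Mapping.single (a - e4 i) (of_nat (Poly_Mapping.lookup a i) * Poly_Mapping.lookup F a))"

lemma minus_single_plus:
  "Poly_Mapping.lookup a i \<noteq> 0 \<Longrightarrow> (a - e4 i) + e4 i = (a :: monom4)"
  by (rule poly_mapping_eqI) (auto simp: lookup_add lookup_minus lookup_single when_def)

lemma lookup_pdiff:
  "Poly_Mapping.lookup (pdiff i F) a =
    of_nat (Poly_Mapping.lookup a i + 1) * Poly_Mapping.lookup F (a + e4 i)"
proof -
  have "Poly_Mapping.lookup (pdiff i F) a = (\<Sum>c\<in>Poly_Mapping.keys F.
      if c = a + e4 i then of_nat (Poly_Mapping.lookup c i) * Poly_Mapping.lookup F c else 0)"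
    unfolding pdiff_def lookup_sum
  proof (rule sum.cong[OF refl])
    fix c assume "c \<in> Poly_Mapping.keys F"
    show "Poly_Mapping.lookup (Poly_Mapping.single (c - e4 i)
        (of_nat (Poly_Mapping.lookup c i) * Poly_Mapping.lookup F c)) a =
      (if c = a + e4 i then of_nat (Poly_Mapping.lookup c i) * Poly_Mapping.lookup F c else 0)"
    proof (cases "Poly_Mapping.lookup c i = 0")
      case False
      then show ?thesis using minus_single_plus[of c i] by (auto simp: lookup_single when_def)
    qed (simp only: of_nat_0 mult_zero_left single_zero lookup_zero if_cancel)
  qed
  also have "\<dots> = of_nat (Poly_Mapping.lookup (a + e4 i) i) * Poly_Mapping.lookup F (a + e4 i)"
    by (simp add: in_keys_iff)
  finally show ?thesis by (simp add: lookup_add)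
qed

definition ddiff :: "'k::comm_ring_1 ^ 4 \<Rightarrow> 'k poly4 \<Rightarrow> 'k poly4" where
  "ddiff v F = (\<Sum>i\<in>UNIV. scale4 (v $ i) (pdiff i F))"

lemma lookup_ddiff: "Poly_Mapping.lookup (ddiff v F) a =
    (\<Sum>i\<in>UNIV. v $ i * (of_nat (Poly_Mapping.lookup a i + 1) * Poly_Mapping.lookup F (a + e4 i)))"
  by (simp add: ddiff_def lookup_sum lookup_pdiff)

lemma ddiff_forms:
  assumes "F \<in> forms (Suc t)"
  shows "ddiff v F \<in> forms t"
proof (rule formsI)
  fix a assume "Poly_Mapping.lookup (ddiff v F) a \<noteq> 0"
  then obtain i where "Poly_Mapping.lookup F (a + e4 i) \<noteq> 0"
    unfolding lookup_ddiff by (metis (no_types, lifting) mult_zero_right sum.neutral)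
  then have "monom_degree (a + e4 i) = Suc t" using assms forms_lookup by blast
  then show "monom_degree a = t" by (simp add: monom_degree_add)
qed

lemma ddiff_add: "ddiff v (F + G) = ddiff v F + ddiff v G"
  by (rule poly_mapping_eqI) (simp add: lookup_ddiff lookup_add algebra_simps sum.distrib)

lemma ddiff_0 [simp]: "ddiff v 0 = 0"
  by (rule poly_mapping_eqI) (simp add: lookup_ddiff)

lemma ddiff_sum: "ddiff v (sum f A) = (\<Sum>x\<in>A. ddiff v (f x))"
  by (induction A rule: infinite_finite_induct) (simp_all add: ddiff_add)

lemma ddiff_scale4: "ddiff v (scale4 c F) = scale4 c (ddiff v F)"
  by (rule poly_mapping_eqI) (simp add: lookup_ddiff sum_distrib_left mult_ac)

lemma ddiff_diff: "ddiff v (F - G) = ddiff v F - ddiff v G"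
  using ddiff_add[of v "F - G" G] by simp

text \<open>The restriction of \<open>F\<close> to the line through \<open>u\<close> in direction
  \<open>v\<close>, which turns directional derivatives into \<open>pderiv\<close>.\<close>

definition line_poly :: "'k::comm_ring_1 ^ 4 \<Rightarrow> 'k ^ 4 \<Rightarrow> 'k poly4 \<Rightarrow> 'k poly" where
  "line_poly u v F = (\<Sum>a\<in>Poly_Mapping.keys F.
     smult (Poly_Mapping.lookup F a) (\<Prod>i\<in>UNIV. [:u $ i, v $ i:] ^ Poly_Mapping.lookup a i))"

lemma poly_line_poly: "poly (line_poly u v F) c = eval4 F (u + c *s v)"
  by (simp add: line_poly_def eval4_def poly_sum poly_prod)

lemma poly_eqI_char_0:
  fixes p q :: "'k::field_char_0 poly"
  assumes "\<And>x. poly p x = poly q x"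
  shows "p = q"
  using assms by (simp add: poly_eq_poly_eq_iff[symmetric] fun_eq_iff)

lemma smult_sum_right: "smult c (sum f A) = (\<Sum>x\<in>A. smult c (f x))"
  by (induction A rule: infinite_finite_induct) (simp_all add: smult_add_right)

lemma pderiv_sum: "pderiv (sum f A) = (\<Sum>x\<in>A. pderiv (f x))"
  by (induction A rule: infinite_finite_induct) (simp_all add: pderiv_add)

lemma line_poly_single: "line_poly u v (Poly_Mapping.single a c) =
    smult c (\<Prod>i\<in>UNIV. [:u $ i, v $ i:] ^ Poly_Mapping.lookup a i)"
  by (simp add: line_poly_def)

lemma line_poly_sum:
  fixes u :: "'k::field_char_0 ^ 4"
  shows "line_poly u v (sum f A) = (\<Sum>x\<in>A. line_poly u v (f x))"
  by (rule poly_eqI_char_0) (simp add: poly_line_poly poly_sum)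

lemma line_poly_scale4:
  fixes u :: "'k::field_char_0 ^ 4"
  shows "line_poly u v (scale4 c F) = smult c (line_poly u v F)"
  by (rule poly_eqI_char_0) (simp add: poly_line_poly)

text \<open>The chain rule; by linearity it reduces to monomials, where it is the product
  rule.\<close>

lemma pderiv_line_poly:
  fixes u v :: "'k::field_char_0 ^ 4"
  shows "pderiv (line_poly u v F) = line_poly u v (ddiff v F)"
proof -
  have single: "pderiv (line_poly u v (Poly_Mapping.single a c))
      = line_poly u v (ddiff v (Poly_Mapping.single a c))" for a c
  proof -
    let ?X = "\<lambda>i. [:u $ i, v $ i:]"
    have "pdiff i (Poly_Mapping.single a c) =
        Poly_Mapping.single (a - e4 i) (of_nat (Poly_Mapping.lookup a i) * c)" for i
      by (simp add: pdiff_def)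
    then have "line_poly u v (ddiff v (Poly_Mapping.single a c)) = (\<Sum>i\<in>UNIV.
        smult (v $ i * (of_nat (Poly_Mapping.lookup a i) * c))
          (\<Prod>j\<in>UNIV. ?X j ^ Poly_Mapping.lookup (a - e4 i) j))"
      by (simp add: ddiff_def line_poly_sum line_poly_scale4 line_poly_single)
    also have "\<dots> = (\<Sum>i\<in>UNIV. smult c ((\<Prod>j\<in>UNIV - {i}. ?X j ^ Poly_Mapping.lookup a j) *
        pderiv (?X i ^ Poly_Mapping.lookup a i)))"
    proof (rule sum.cong[OF refl])
      fix i :: 4
      have "(\<Prod>j\<in>UNIV. ?X j ^ Poly_Mapping.lookup (a - e4 i) j) =
          ?X i ^ (Poly_Mapping.lookup a i - 1) * (\<Prod>j\<in>UNIV - {i}. ?X j ^ Poly_Mapping.lookup (a - e4 i) j)"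
        by (subst prod.remove[of _ i]) (simp_all add: lookup_minus lookup_single)
      also have "(\<Prod>j\<in>UNIV - {i}. ?X j ^ Poly_Mapping.lookup (a - e4 i) j) =
          (\<Prod>j\<in>UNIV - {i}. ?X j ^ Poly_Mapping.lookup a j)"
        by (intro prod.cong) (auto simp: lookup_minus lookup_single when_def)
      finally show "smult (v $ i * (of_nat (Poly_Mapping.lookup a i) * c))
          (\<Prod>j\<in>UNIV. ?X j ^ Poly_Mapping.lookup (a - e4 i) j) =
        smult c ((\<Prod>j\<in>UNIV - {i}. ?X j ^ Poly_Mapping.lookup a j) *
          pderiv (?X i ^ Poly_Mapping.lookup a i))"
        by (simp add: pderiv_power pderiv_pCons mult_ac)
    qed
    also have "\<dots> = pderiv (line_poly u v (Poly_Mapping.single a c))"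
      by (simp add: line_poly_single pderiv_smult pderiv_prod smult_sum_right)
    finally show ?thesis by simp
  qed
  have "pderiv (line_poly u v F) = (\<Sum>a\<in>Poly_Mapping.keys F.
      pderiv (line_poly u v (Poly_Mapping.single a (Poly_Mapping.lookup F a))))"
    by (subst sum_monomials[of F]) (simp only: line_poly_sum pderiv_sum)
  also have "\<dots> = line_poly u v (ddiff v F)"
    unfolding single by (subst (2) sum_monomials[of F]) (simp only: line_poly_sum ddiff_sum)
  finally show ?thesis .
qed

text \<open>On the line through \<open>v\<close> in its own direction, \<open>F\<close> is
  \<open>eval4 F v\<close> times \<open>(1 + c) ^ t\<close>; differentiating at 0 gives the
  formula.\<close>

lemma euler_formula:
  fixes v :: "'k::field_char_0 ^ 4"
  assumes "F \<in> forms t"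
  shows "eval4 (ddiff v F) v = of_nat t * eval4 F v"
proof -
  have "line_poly v v F = smult (eval4 F v) ([:1, 1:] ^ t)"
  proof (rule poly_eqI_char_0)
    fix c
    have "v + c *s v = (1 + c) *s v" by (simp add: vec.scale_left_distrib)
    then show "poly (line_poly v v F) c = poly (smult (eval4 F v) ([:1, 1:] ^ t)) c"
      by (simp add: poly_line_poly eval4_forms_scale[OF assms] mult.commute)
  qed
  then have "poly (line_poly v v (ddiff v F)) 0 = of_nat t * eval4 F v"
    unfolding pderiv_line_poly[symmetric]
    by (simp add: pderiv_smult pderiv_power pderiv_pCons)
  then show ?thesis by (simp add: poly_line_poly)
qed

text \<open>The exponents are the digits of this number in base \<open>N\<close>.\<close>

definition monom_weight :: "monom4 \<Rightarrow> nat \<Rightarrow> nat" where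
  "monom_weight a N = Poly_Mapping.lookup a 0 + N * (Poly_Mapping.lookup a 1 +
     N * (Poly_Mapping.lookup a 2 + N * Poly_Mapping.lookup a 3))"

lemma digit_eq:
  fixes x y N p q :: nat
  assumes "x < N" "y < N" "x + N * p = y + N * q"
  shows "x = y \<and> p = q"
proof
  show "x = y" using assms by (metis mod_less mod_mult_self2)
  then show "p = q" using assms by simp
qed

lemma monom_weight_inj:
  assumes "\<And>i. Poly_Mapping.lookup a i < N" "\<And>i. Poly_Mapping.lookup b i < N"
    "monom_weight a N = monom_weight b N"
  shows "a = b"
proof (rule poly_mapping_eqI)
  have "Poly_Mapping.lookup a 0 = Poly_Mapping.lookup b 0"
    "Poly_Mapping.lookup a 1 = Poly_Mapping.lookup b 1"
    "Poly_Mapping.lookup a 2 = Poly_Mapping.lookup b 2"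
    "N * Poly_Mapping.lookup a 3 = N * Poly_Mapping.lookup b 3"
    using digit_eq[OF assms(1,2)] assms(3) unfolding monom_weight_def by metis+
  moreover have "N > 0" using assms(1)[of 0] by simp
  ultimately show "Poly_Mapping.lookup a i = Poly_Mapping.lookup b i" for i
    using UNIV_I[of i] unfolding UNIV_4_explicit by auto
qed

text \<open>Kronecker substitution: distinct monomials become distinct powers of one variable.\<close>

lemma exists_eval4_nonzero:
  fixes G :: "'k::field_char_0 poly4"
  assumes "G \<noteq> 0"
  obtains v where "v \<noteq> 0" "eval4 G v \<noteq> 0"
proof -
  \<comment> \<open>Larger than every exponent, so that the weight determines the digits.\<close>
  define N where "N = (\<Sum>a\<in>Poly_Mapping.keys G. \<Sum>i\<in>UNIV. Poly_Mapping.lookup a i) + 1"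
  have N: "Poly_Mapping.lookup a i < N" if "a \<in> Poly_Mapping.keys G" for a i
  proof -
    have "Poly_Mapping.lookup a i \<le> (\<Sum>i\<in>UNIV. Poly_Mapping.lookup a i)"
      by (intro member_le_sum) auto
    also have "\<dots> \<le> (\<Sum>a\<in>Poly_Mapping.keys G. \<Sum>i\<in>UNIV. Poly_Mapping.lookup a i)"
      using that by (intro member_le_sum) auto
    finally show ?thesis by (simp add: N_def)
  qed
  define p where "p = (\<Sum>a\<in>Poly_Mapping.keys G. monom (Poly_Mapping.lookup G a) (monom_weight a N))"
  define w :: "'k \<Rightarrow> 'k ^ 4" where
    "w z = (\<chi> i. if i = 0 then z else if i = 1 then z ^ N else if i = 2 then z ^ (N * N) else z ^ (N * (N * N)))" for z
  have "monom_val (w z) a = z ^ monom_weight a N" for z a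
  proof -
    have "monom_val (w z) a = w z $ 0 ^ Poly_Mapping.lookup a 0 * (w z $ 1 ^ Poly_Mapping.lookup a 1 *
        (w z $ 2 ^ Poly_Mapping.lookup a 2 * w z $ 3 ^ Poly_Mapping.lookup a 3))"
      unfolding UNIV_4_explicit by simp
    also have "\<dots> = z ^ monom_weight a N"
      by (simp add: w_def monom_weight_def power_add power_mult distrib_left mult.assoc
          flip: power_mult)
    finally show ?thesis .
  qed
  then have eval: "poly p z = eval4 G (w z)" for z
    by (simp add: p_def eval4_def poly_sum poly_monom)
  obtain a where a: "a \<in> Poly_Mapping.keys G" using assms by fastforce
  have "coeff p (monom_weight a N) = (\<Sum>b\<in>Poly_Mapping.keys G. if b = a then Poly_Mapping.lookup G b else 0)"
    unfolding p_def coeff_sum using N monom_weight_inj[of _ N a] a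
    by (intro sum.cong) (auto simp: coeff_monom)
  also have "\<dots> \<noteq> 0" using a by (simp add: in_keys_iff)
  finally have "p \<noteq> 0" by auto
  \<comment> \<open>Excluding 0 as well makes the vector \<open>w z\<close> nonzero.\<close>
  then have "finite ({z. poly p z = 0} \<union> {0})" using poly_roots_finite by blast
  then obtain z where "z \<notin> {z. poly p z = 0} \<union> {0}"
    using ex_new_if_finite[OF infinite_UNIV_char_0] by blast
  then have z: "z \<noteq> 0" "eval4 G (w z) \<noteq> 0" using eval by auto
  moreover have "w z \<noteq> 0"
  proof
    assume "w z = 0"
    then have "w z $ 0 = 0" by simp
    then show False using z(1) by (simp add: w_def)
  qed
  ultimately show thesis using that by blast
qed

text \<open>In characteristic 0 the derivative vanishes iff the restriction to every line in
  direction \<open>v\<close> is constant; for forms and nonzero \<open>v\<close> this describes the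
  cones with vertex \<open>v\<close>.\<close>

lemma ddiff_eq_0_iff:
  fixes F :: "'k::field_char_0 poly4"
  shows "ddiff v F = 0 \<longleftrightarrow> (\<forall>u c. eval4 F (u + c *s v) = eval4 F u)"
proof
  assume F: "ddiff v F = 0"
  show "\<forall>u c. eval4 F (u + c *s v) = eval4 F u"
  proof (intro allI)
    fix u c
    have "pderiv (line_poly u v F) = 0"
      unfolding pderiv_line_poly F by (simp add: line_poly_def)
    then obtain e where "line_poly u v F = [:e:]"
      by (metis degree_eq_zeroE pderiv_eq_0_iff)
    then have "eval4 F (u + c *s v) = e" for c using poly_line_poly[of u v F] by simp
    from this[of c] this[of 0] show "eval4 F (u + c *s v) = eval4 F u" by simp
  qed
next
  assume inv: "\<forall>u c. eval4 F (u + c *s v) = eval4 F u"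
  have "eval4 (ddiff v F) u = 0" for u
  proof -
    have "line_poly u v F = [:eval4 F u:]"
      by (rule poly_eqI_char_0) (simp add: poly_line_poly inv)
    then have "poly (line_poly u v (ddiff v F)) 0 = 0"
      unfolding pderiv_line_poly[symmetric] by simp
    then show ?thesis by (simp add: poly_line_poly)
  qed
  then show "ddiff v F = 0" by (metis exists_eval4_nonzero)
qed

section \<open>Apolarity\<close>

definition mfact :: "monom4 \<Rightarrow> 'k::field_char_0" where
  "mfact a = (\<Prod>i\<in>UNIV. fact (Poly_Mapping.lookup a i))"

lemma mfact_nonzero [simp]: "(mfact a :: 'k::field_char_0) \<noteq> 0"
  by (simp add: mfact_def)

lemma mfact_0 [simp]: "mfact 0 = 1"
  by (simp add: mfact_def)

lemma mfact_plus_single: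
  "mfact (a + e4 i) = (of_nat (Poly_Mapping.lookup a i + 1) * mfact a :: 'k::field_char_0)"
proof -
  have "mfact (a + e4 i) = fact (Poly_Mapping.lookup a i + 1) *
      (\<Prod>j\<in>UNIV - {i}. fact (Poly_Mapping.lookup (a + e4 i) j) :: 'k)"
    unfolding mfact_def by (subst prod.remove[of _ i]) (simp_all add: lookup_add)
  also have "(\<Prod>j\<in>UNIV - {i}. fact (Poly_Mapping.lookup (a + e4 i) j) :: 'k) =
      (\<Prod>j\<in>UNIV - {i}. fact (Poly_Mapping.lookup a j))"
    by (intro prod.cong) (auto simp: lookup_add lookup_single when_def)
  also have "fact (Poly_Mapping.lookup a i + 1) * \<dots> = of_nat (Poly_Mapping.lookup a i + 1) * mfact a"
    unfolding mfact_def by (subst (2) prod.remove[of _ i]) (simp_all add: mult.assoc)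
  finally show ?thesis .
qed

text \<open>The value at the origin of \<open>F\<close>, read as a differential operator, applied to
  \<open>G\<close>; the factorials make multiplication by a variable adjoint to the partial
  derivative.\<close>

definition apolar_pairing :: "'k::field_char_0 poly4 \<Rightarrow> 'k poly4 \<Rightarrow> 'k" where
  "apolar_pairing F G = (\<Sum>a\<in>Poly_Mapping.keys G.
     Poly_Mapping.lookup F a * Poly_Mapping.lookup G a * mfact a)"

lemma apolar_pairing_superset:
  assumes "finite A" "Poly_Mapping.keys G \<subseteq> A"
  shows "apolar_pairing F G = (\<Sum>a\<in>A. Poly_Mapping.lookup F a * Poly_Mapping.lookup G a * mfact a)"
  unfolding apolar_pairing_def using assms by (intro sum.mono_neutral_left) (auto simp: in_keys_iff)

lemma apolar_pairing_add_left: "apolar_pairing (F + F') G = apolar_pairing F G + apolar_pairing F' G"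
  by (simp add: apolar_pairing_def lookup_add algebra_simps sum.distrib)

lemma apolar_pairing_0_left [simp]: "apolar_pairing 0 G = 0"
  by (simp add: apolar_pairing_def)

lemma apolar_pairing_0_right [simp]: "apolar_pairing F 0 = 0"
  by (simp add: apolar_pairing_def)

lemma apolar_pairing_sum_left: "apolar_pairing (sum f A) G = (\<Sum>x\<in>A. apolar_pairing (f x) G)"
  by (induction A rule: infinite_finite_induct) (simp_all add: apolar_pairing_add_left)

lemma apolar_pairing_scale4_left: "apolar_pairing (scale4 c F) G = c * apolar_pairing F G"
  by (simp add: apolar_pairing_def sum_distrib_left mult.assoc)

lemma apolar_pairing_diff_left: "apolar_pairing (F - F') G = apolar_pairing F G - apolar_pairing F' G"
  using apolar_pairing_add_left[of "F - F'" F' G] by simp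

lemma apolar_pairing_add_right: "apolar_pairing F (G + G') = apolar_pairing F G + apolar_pairing F G'"
proof -
  let ?A = "Poly_Mapping.keys G \<union> Poly_Mapping.keys G'"
  have "apolar_pairing F H = (\<Sum>a\<in>?A. Poly_Mapping.lookup F a * Poly_Mapping.lookup H a * mfact a)"
    if "Poly_Mapping.keys H \<subseteq> ?A" for H
    using that by (intro apolar_pairing_superset) auto
  from this[of G] this[of G'] this[of "G + G'"] show ?thesis
    using keys_add[of G G'] by (auto simp: lookup_add algebra_simps sum.distrib)
qed

lemma apolar_pairing_scale4_right: "apolar_pairing F (scale4 c G) = c * apolar_pairing F G"
proof -
  have "apolar_pairing F (scale4 c G) = (\<Sum>a\<in>Poly_Mapping.keys G.
      Poly_Mapping.lookup F a * Poly_Mapping.lookup (scale4 c G) a * mfact a)"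
    by (intro apolar_pairing_superset keys_scale4) simp
  then show ?thesis by (simp add: apolar_pairing_def sum_distrib_left mult_ac)
qed

lemma apolar_pairing_sum_right: "apolar_pairing F (sum f A) = (\<Sum>x\<in>A. apolar_pairing F (f x))"
  by (induction A rule: infinite_finite_induct) (simp_all add: apolar_pairing_add_right)

section \<open>Multiplication by linear forms as the adjoint of differentiation\<close>

lemma lookup_single_mult:
  "Poly_Mapping.lookup (Poly_Mapping.single b u * F) c =
    (\<Sum>e\<in>Poly_Mapping.keys F. if b + e = c then u * Poly_Mapping.lookup F e else 0)"
  by (subst sum_monomials[of F], simp only: sum_distrib_left mult_single lookup_sum)
    (simp add: lookup_single when_def)

lemma lookup_var4_mult_plus:
  "Poly_Mapping.lookup (var4 i * F) (c + e4 i) = Poly_Mapping.lookup F c"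
proof -
  have "Poly_Mapping.lookup (var4 i * F) (c + e4 i) =
      (\<Sum>e\<in>Poly_Mapping.keys F. if e = c then Poly_Mapping.lookup F e else 0)"
    unfolding var4_def lookup_single_mult by (intro sum.cong) (auto simp: add.commute)
  then show ?thesis by (simp add: in_keys_iff)
qed

lemma lookup_var4_mult_eq_0:
  assumes "Poly_Mapping.lookup c i = 0"
  shows "Poly_Mapping.lookup (var4 i * F) c = 0"
  unfolding var4_def lookup_single_mult
proof (rule sum.neutral, intro ballI)
  fix e
  have "e4 i + e \<noteq> c"
  proof
    assume "e4 i + e = c"
    then have "Poly_Mapping.lookup c i = 1 + Poly_Mapping.lookup e i" by (auto simp: lookup_add)
    then show False using assms by simp
  qed
  then show "(if e4 i + e = c then 1 * Poly_Mapping.lookup F e else 0) = 0" by simp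
qed

text \<open>Monomials of \<open>G\<close> without \<open>x_i\<close> do not occur in
  \<open>x_i F\<close>; the others are reindexed by removing one \<open>x_i\<close>, and the
  exponent factor of the derivative is the quotient of the two factorials.\<close>

lemma apolar_pairing_var4_mult: "apolar_pairing (var4 i * F) G = apolar_pairing F (pdiff i G)"
proof -
  let ?K = "{c \<in> Poly_Mapping.keys G. Poly_Mapping.lookup c i \<noteq> 0}"
  let ?h = "\<lambda>c. Poly_Mapping.lookup (var4 i * F) c * Poly_Mapping.lookup G c * mfact c"
  have "apolar_pairing (var4 i * F) G = sum ?h ?K"
    unfolding apolar_pairing_def
    by (intro sum.mono_neutral_right) (auto simp: lookup_var4_mult_eq_0)
  also have "\<dots> = (\<Sum>a\<in>(\<lambda>c. c - e4 i) ` ?K. ?h (a + e4 i))"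
  proof (subst sum.reindex)
    show "inj_on (\<lambda>c. c - e4 i) ?K"
      by (intro inj_onI) (metis (mono_tags, lifting) mem_Collect_eq minus_single_plus)
    show "sum ?h ?K = sum ((\<lambda>a. ?h (a + e4 i)) \<circ> (\<lambda>c. c - e4 i)) ?K"
      using minus_single_plus by (intro sum.cong) auto
  qed
  also have "\<dots> = (\<Sum>a\<in>(\<lambda>c. c - e4 i) ` ?K.
      Poly_Mapping.lookup F a * Poly_Mapping.lookup (pdiff i G) a * mfact a)"
    unfolding lookup_var4_mult_plus lookup_pdiff mfact_plus_single
    by (intro sum.cong) (simp_all only: mult_ac)
  also have "\<dots> = apolar_pairing F (pdiff i G)"
  proof (rule apolar_pairing_superset[symmetric])
    show "Poly_Mapping.keys (pdiff i G) \<subseteq> (\<lambda>c. c - e4 i) ` ?K"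
    proof
      fix a assume "a \<in> Poly_Mapping.keys (pdiff i G)"
      then have "Poly_Mapping.lookup G (a + e4 i) \<noteq> 0" by (auto simp: in_keys_iff lookup_pdiff)
      then have "a + e4 i \<in> ?K" by (simp add: in_keys_iff lookup_add)
      then show "a \<in> (\<lambda>c. c - e4 i) ` ?K" by (rule rev_image_eqI) simp
    qed
  qed simp
  finally show ?thesis .
qed

lemma apolar_pairing_linear_form_mult: "apolar_pairing (linear_form v * F) G = apolar_pairing F (ddiff v G)"
proof -
  have "linear_form v * F = (\<Sum>i\<in>UNIV. scale4 (v $ i) (var4 i * F))"
    by (simp add: linear_form_def sum_distrib_right scale4_def mult.assoc)
  then show ?thesis
    by (simp add: ddiff_def apolar_pairing_sum_left apolar_pairing_sum_right apolar_pairing_scale4_left apolar_pairing_scale4_right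
        apolar_pairing_var4_mult)
qed

text \<open>Each linear factor moves to the other side as a derivative along \<open>v\<close>, and
  Euler's formula contributes the factors of \<open>fact t\<close> one by one.\<close>

lemma apolar_pairing_linear_form_power:
  "F \<in> forms t \<Longrightarrow> apolar_pairing (linear_form v ^ t) F = fact t * eval4 F v"
proof (induction t arbitrary: F)
  case 0
  then have "Poly_Mapping.keys F \<subseteq> {0}" by (auto simp: forms_def)
  then have "apolar_pairing 1 F = Poly_Mapping.lookup F 0" "eval4 F v = Poly_Mapping.lookup F 0"
    by (simp_all add: apolar_pairing_superset[of "{0}"] eval4_superset[of "{0}"])
  then show ?case by simp
next
  case (Suc t)
  then show ?case
    using Suc.IH[OF ddiff_forms[OF Suc.prems]] euler_formula[OF Suc.prems, of v]
    by (simp add: apolar_pairing_linear_form_mult mult.assoc mult.left_commute)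
qed

text \<open>The pairing is perfect on forms of degree \<open>t\<close>: dividing the values on
  monomials by \<open>mfact\<close> gives the coefficients of \<open>H\<close>. Both orders are
  stated since later one functional is represented on each side.\<close>

lemma functional_represented:
  fixes \<phi> :: "'k::field_char_0 poly4 \<Rightarrow> 'k"
  assumes "\<And>F G. \<phi> (F + G) = \<phi> F + \<phi> G" "\<And>c F. \<phi> (scale4 c F) = c * \<phi> F"
  obtains H where "H \<in> forms t" "\<And>F. F \<in> forms t \<Longrightarrow> \<phi> F = apolar_pairing F H" "\<And>F. F \<in> forms t \<Longrightarrow> \<phi> F = apolar_pairing H F"
proof
  define H where "H = (\<Sum>a | monom_degree a = t.
    Poly_Mapping.single a (\<phi> (Poly_Mapping.single a 1) / mfact a))"
  show "H \<in> forms t" unfolding H_def by (intro forms_sum forms_single) simp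
  have lookup_H: "Poly_Mapping.lookup H a = \<phi> (Poly_Mapping.single a 1) / mfact a"
    if "monom_degree a = t" for a
    using that finite_monom_degree[of t] by (simp add: H_def lookup_sum lookup_single when_def)
  have "\<phi> 0 = 0" using assms(2)[of 0 0] by simp
  then have \<phi>_sum: "\<phi> (sum f A) = (\<Sum>x\<in>A. \<phi> (f x))" for f :: "monom4 \<Rightarrow> 'k poly4" and A
    by (induction A rule: infinite_finite_induct) (simp_all add: assms)
  have \<phi>_eq: "\<phi> F = (\<Sum>a\<in>Poly_Mapping.keys F. Poly_Mapping.lookup F a * \<phi> (Poly_Mapping.single a 1))" for F
  proof -
    have "Poly_Mapping.single a (Poly_Mapping.lookup F a) =
        scale4 (Poly_Mapping.lookup F a) (Poly_Mapping.single a 1)" for a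
      by (simp add: scale4_def mult_single)
    then have *: "F = (\<Sum>a\<in>Poly_Mapping.keys F. scale4 (Poly_Mapping.lookup F a) (Poly_Mapping.single a 1))"
      using sum_monomials[of F] by simp
    show ?thesis by (subst (1) *) (simp only: \<phi>_sum assms(2))
  qed
  show *: "\<phi> F = apolar_pairing H F" if "F \<in> forms t" for F
    unfolding apolar_pairing_def using that
    by (subst \<phi>_eq, intro sum.cong refl) (simp add: forms_def lookup_H)
  have "apolar_pairing F H = apolar_pairing H F" for F
  proof -
    let ?A = "Poly_Mapping.keys F \<union> Poly_Mapping.keys H"
    show ?thesis
      using apolar_pairing_superset[of ?A H F] apolar_pairing_superset[of ?A F H] by (simp add: mult_ac)
  qed
  then show "\<phi> F = apolar_pairing F H" if "F \<in> forms t" for F using *[OF that] by simp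
qed

text \<open>A nonconstant term of \<open>r\<close> pushes every term of \<open>F\<close> beyond
  degree \<open>k\<close>, so up to there multiplication acts through the constant term of
  \<open>r\<close>.\<close>

lemma lookup_mult_low:
  assumes "\<And>c. monom_degree c < k \<Longrightarrow> Poly_Mapping.lookup F c = 0" "monom_degree c \<le> k"
  shows "Poly_Mapping.lookup (r * F) c = Poly_Mapping.lookup r 0 * Poly_Mapping.lookup F c"
proof -
  have single: "Poly_Mapping.lookup (Poly_Mapping.single b u * F) c =
      (if b = 0 then u * Poly_Mapping.lookup F c else 0)" for b u
  proof (cases "b = 0")
    case True
    then show ?thesis
      by (auto simp: lookup_single_mult in_keys_iff)
  next
    case False
    have "Poly_Mapping.lookup F e = 0" if "b + e = c" for e
    proof (rule assms(1))
      have "monom_degree b + monom_degree e \<le> k" using assms(2) that monom_degree_add by metis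
      then show "monom_degree e < k" using False monom_degree_eq_0_iff[of b] by linarith
    qed
    then show ?thesis using False unfolding lookup_single_mult by (auto intro!: sum.neutral)
  qed
  have "r * F = (\<Sum>b\<in>Poly_Mapping.keys r. Poly_Mapping.single b (Poly_Mapping.lookup r b) * F)"
    by (subst (1) sum_monomials[of r]) (simp only: sum_distrib_right)
  then have "Poly_Mapping.lookup (r * F) c = (\<Sum>b\<in>Poly_Mapping.keys r.
      if b = 0 then Poly_Mapping.lookup r b * Poly_Mapping.lookup F c else 0)"
    by (simp only: lookup_sum single)
  then show ?thesis by (simp add: in_keys_iff)
qed

text \<open>By \<open>lookup_mult_low\<close> multiplication acts on the lowest degree
  \<open>k\<close> by scalars, so vanishing below \<open>k\<close> and orthogonality to a form of
  degree \<open>k\<close> pass from the generators to the ideal.\<close>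

lemma ideal_span_low:
  assumes "G \<subseteq> forms k" "F \<in> ideal.span G"
  shows "monom_degree c < k \<Longrightarrow> Poly_Mapping.lookup F c = 0"
    and "H \<in> forms k \<Longrightarrow> (\<And>g. g \<in> G \<Longrightarrow> apolar_pairing g H = 0) \<Longrightarrow> apolar_pairing F H = 0"
proof -
  let ?low = "\<lambda>F :: 'a poly4. \<forall>c. monom_degree c < k \<longrightarrow> Poly_Mapping.lookup F c = 0"
  have low_G: "?low g" if "g \<in> G" for g
    using that assms(1) forms_lookup[of g k] by force
  have low_mult: "?low (r * F)" if "?low F" for r F
    using that lookup_mult_low[of k F _ r] by simp
  have "ideal.subspace {F. ?low F}"
    using low_mult by (auto simp: ideal.subspace_def lookup_add)
  then have "ideal.span G \<subseteq> {F. ?low F}"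
    using low_G by (intro ideal.span_minimal) auto
  then show "monom_degree c < k \<Longrightarrow> Poly_Mapping.lookup F c = 0" using assms(2) by blast
  assume H: "H \<in> forms k" "\<And>g. g \<in> G \<Longrightarrow> apolar_pairing g H = 0"
  have "apolar_pairing (r * F) H = Poly_Mapping.lookup r 0 * apolar_pairing F H" if "?low F" for r F
  proof -
    have "Poly_Mapping.lookup (r * F) a = Poly_Mapping.lookup r 0 * Poly_Mapping.lookup F a"
      if "a \<in> Poly_Mapping.keys H" for a
      using that H(1) \<open>?low F\<close> by (intro lookup_mult_low[of k]) (auto simp: forms_def)
    then show ?thesis unfolding apolar_pairing_def sum_distrib_left by (intro sum.cong) (auto simp: mult.assoc)
  qed
  then have "ideal.subspace {F. ?low F \<and> apolar_pairing F H = 0}"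
    using low_mult by (auto simp: ideal.subspace_def lookup_add apolar_pairing_add_left)
  then have "ideal.span G \<subseteq> {F. ?low F \<and> apolar_pairing F H = 0}"
    using low_G H(2) by (intro ideal.span_minimal) auto
  then show "apolar_pairing F H = 0" using assms(2) by blast
qed

text \<open>Pairing with \<open>\<Phi>\<close> kills the ideal and, as multiplication by the linear
  form is adjoint to \<open>ddiff P\<close>, also the image of multiplication; but it does not kill
  all forms of degree \<open>k\<close>.\<close>

lemma not_surjective:
  assumes "G \<subseteq> forms k" "k > 0"
    and \<Phi>: "\<Phi> \<in> forms k" "\<Phi> \<noteq> 0" "ddiff P \<Phi> = 0" "\<And>g. g \<in> G \<Longrightarrow> apolar_pairing g \<Phi> = 0"
  shows "quotient_mult (ideal.span G) (linear_form P) ` quotient_piece (ideal.span G) (k - 1)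
    \<noteq> quotient_piece (ideal.span G) k"
proof
  let ?J = "ideal.span G" and ?L = "linear_form P"
  assume eq: "quotient_mult ?J ?L ` quotient_piece ?J (k - 1) = quotient_piece ?J k"
  obtain a where a: "Poly_Mapping.lookup \<Phi> a \<noteq> 0" using \<Phi>(2) by (metis lookup_zero poly_mapping_eqI)
  \<comment> \<open>Any monomial that occurs in \<open>\<Phi>\<close> pairs nontrivially with
    it.\<close>
  define F where "F = Poly_Mapping.single a (1 :: 'a)"
  have "monom_degree a = k" using a \<Phi>(1) forms_lookup by blast
  then have F: "F \<in> forms k" by (simp add: F_def forms_single)
  have "apolar_pairing F \<Phi> = (\<Sum>c\<in>Poly_Mapping.keys \<Phi>. if c = a then Poly_Mapping.lookup \<Phi> c * mfact c else 0)"
    unfolding apolar_pairing_def F_def by (intro sum.cong) (auto simp: lookup_single)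
  then have F\<Phi>: "apolar_pairing F \<Phi> \<noteq> 0" using a by (simp add: in_keys_iff)
  have "residue_class ?J F \<in> quotient_mult ?J ?L ` quotient_piece ?J (k - 1)"
    unfolding eq using F by (simp add: quotient_piece_def)
  then obtain F' where F': "F' \<in> forms (k - 1)"
    "residue_class ?J F = quotient_mult ?J ?L (residue_class ?J F')"
    by (auto simp: quotient_piece_def)
  have "F \<in> residue_class ?J F" by (simp add: residue_class_def ideal.span_zero)
  then obtain E where E: "E - F' \<in> ?J" "F - ?L * E \<in> ?J"
    unfolding F'(2) by (auto simp: quotient_mult_def residue_class_def)
  have "F - ?L * F' = (F - ?L * E) + ?L * (E - F')" by (simp add: algebra_simps)
  also have "\<dots> \<in> ?J" using E by (intro ideal.span_add ideal.span_scale)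
  finally have "apolar_pairing (F - ?L * F') \<Phi> = 0"
    using ideal_span_low(2)[OF assms(1)] \<Phi>(1,4) by blast
  then show False using F\<Phi> \<Phi>(3) by (simp add: apolar_pairing_diff_left apolar_pairing_linear_form_mult)
qed

text \<open>A functional that vanishes on the derivatives of the orthogonal complement of
  \<open>G\<close> but not at \<open>H\<close> is pairing with some \<open>F \<noteq> 0\<close>. By
  adjointness the product of \<open>F\<close> with the linear form is orthogonal to that complement,
  hence lies in the span of \<open>G\<close>, and the class of \<open>F\<close> is a nonzero element
  of the kernel.\<close>

lemma not_injective:
  assumes "G \<subseteq> forms k" "k > 0"
    and H: "H \<in> forms (k - 1)"
      "\<And>\<Phi>. \<Phi> \<in> forms k \<Longrightarrow> (\<And>g. g \<in> G \<Longrightarrow> apolar_pairing g \<Phi> = 0) \<Longrightarrow> ddiff P \<Phi> \<noteq> H"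
  shows "\<not> inj_on (quotient_mult (ideal.span G) (linear_form P)) (quotient_piece (ideal.span G) (k - 1))"
proof
  let ?J = "ideal.span G" and ?L = "linear_form P"
  assume inj: "inj_on (quotient_mult ?J ?L) (quotient_piece ?J (k - 1))"
  let ?A = "{\<Phi> \<in> forms k. \<forall>g\<in>G. apolar_pairing g \<Phi> = 0}"
  have "poly4.subspace (ddiff P ` ?A)"
  proof (rule poly4.subspaceI)
    show "0 \<in> ddiff P ` ?A" by (rule rev_image_eqI[of 0]) auto
    show "x + y \<in> ddiff P ` ?A" if xy: "x \<in> ddiff P ` ?A" "y \<in> ddiff P ` ?A" for x y
    proof -
      obtain \<Phi> where "x = ddiff P \<Phi>" "\<Phi> \<in> ?A" using xy(1) by (rule imageE)
      moreover obtain \<Psi> where "y = ddiff P \<Psi>" "\<Psi> \<in> ?A" using xy(2) by (rule imageE)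
      ultimately show ?thesis
        by (intro rev_image_eqI[of "\<Phi> + \<Psi>"]) (auto simp: forms_add apolar_pairing_add_right ddiff_add)
    qed
    show "scale4 c x \<in> ddiff P ` ?A" if x: "x \<in> ddiff P ` ?A" for c x
    proof -
      obtain \<Phi> where "x = ddiff P \<Phi>" "\<Phi> \<in> ?A" using x by (rule imageE)
      then show ?thesis
        by (intro rev_image_eqI[of "scale4 c \<Phi>"]) (auto simp: forms_scale4 apolar_pairing_scale4_right ddiff_scale4)
    qed
  qed
  then have "poly4.span (ddiff P ` ?A) = ddiff P ` ?A" by (simp only: poly4.span_eq_iff)
  moreover have "H \<notin> ddiff P ` ?A" using H(2) by blast
  ultimately have "H \<notin> poly4.span (ddiff P ` ?A)" by (simp only: not_False_eq_True)
  then obtain \<phi> where \<phi>: "\<And>F G. \<phi> (F + G) = \<phi> F + \<phi> G" "\<And>c F. \<phi> (scale4 c F) = c * \<phi> F"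
    "\<And>s. s \<in> ddiff P ` ?A \<Longrightarrow> \<phi> s = 0" "\<phi> H = 1"
    by (rule poly4.separating_functional) (rule that; assumption)
  obtain F where F: "F \<in> forms (k - 1)" "\<And>E. E \<in> forms (k - 1) \<Longrightarrow> \<phi> E = apolar_pairing F E"
    by (rule functional_represented[of \<phi> "k - 1", OF \<phi>(1,2)]) (rule that; assumption)
  have "F \<noteq> 0" using F(2)[OF H(1)] \<phi>(4) by auto
  have LF: "?L * F \<in> forms k" using forms_mult[OF linear_form_forms F(1)] assms(2) by simp
  \<comment> \<open>Double orthogonality: a functional separating the product from \<open>G\<close>
    would be represented by an element of the complement that is not orthogonal to the
    product.\<close>
  have "?L * F \<in> poly4.span G"
  proof (rule ccontr)
    assume "?L * F \<notin> poly4.span G"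
    then obtain \<psi> where \<psi>: "\<And>F G. \<psi> (F + G) = \<psi> F + \<psi> G" "\<And>c F. \<psi> (scale4 c F) = c * \<psi> F"
      "\<And>s. s \<in> G \<Longrightarrow> \<psi> s = 0" "\<psi> (?L * F) = 1"
      by (rule poly4.separating_functional) (rule that; assumption)
    obtain \<Phi> where \<Phi>: "\<Phi> \<in> forms k" "\<And>E. E \<in> forms k \<Longrightarrow> \<psi> E = apolar_pairing E \<Phi>"
      by (rule functional_represented[of \<psi> k, OF \<psi>(1,2)]) (rule that; assumption)
    have "apolar_pairing g \<Phi> = 0" if "g \<in> G" for g
      using \<Phi>(2)[of g] \<psi>(3)[OF that] assms(1) that by auto
    then have "\<Phi> \<in> ?A" using \<Phi>(1) by blast
    moreover have "ddiff P \<Phi> \<in> forms (k - 1)" using ddiff_forms[of \<Phi> "k - 1"] \<Phi>(1) assms(2) by simp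
    ultimately have "apolar_pairing F (ddiff P \<Phi>) = 0" using \<phi>(3) F(2) by fastforce
    then show False using \<psi>(4) \<Phi>(2)[OF LF] by (simp add: apolar_pairing_linear_form_mult)
  qed
  moreover have "poly4.span G \<subseteq> ?J"
    by (rule poly4.span_minimal)
      (auto simp: poly4.subspace_def scale4_def ideal.span_base ideal.span_zero ideal.span_add ideal.span_scale)
  ultimately have LFJ: "?L * F \<in> ?J" by blast
  have mult: "quotient_mult ?J ?L (residue_class ?J E) = ?J" if LE: "?L * E \<in> ?J" for E
  proof (intro set_eqI iffI)
    fix x assume "x \<in> quotient_mult ?J ?L (residue_class ?J E)"
    then obtain D where D: "D - E \<in> ?J" "x - ?L * D \<in> ?J"
      by (auto simp: quotient_mult_def residue_class_def)
    have "x = (x - ?L * D) + ?L * (D - E) + ?L * E" by (simp add: algebra_simps)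
    also have "\<dots> \<in> ?J" by (rule ideal.span_add[OF ideal.span_add[OF D(2) ideal.span_scale[OF D(1)]] LE])
    finally show "x \<in> ?J" .
  next
    fix x assume "x \<in> ?J"
    then have "x - ?L * E \<in> ?J" using LE by (rule ideal.span_diff)
    moreover have "E - E \<in> ?J" by (simp add: ideal.span_zero)
    ultimately show "x \<in> quotient_mult ?J ?L (residue_class ?J E)"
      unfolding quotient_mult_def residue_class_def by blast
  qed
  have "residue_class ?J F = residue_class ?J 0"
    using inj
  proof (rule inj_onD)
    show "quotient_mult ?J ?L (residue_class ?J F) = quotient_mult ?J ?L (residue_class ?J 0)"
      using mult[OF LFJ] mult[of 0] by (simp add: ideal.span_zero)
  qed (use F(1) in \<open>auto simp: quotient_piece_def\<close>)
  moreover have "F \<in> residue_class ?J F" by (simp add: residue_class_def ideal.span_zero)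
  ultimately have "F \<in> ?J" by (simp add: residue_class_def)
  \<comment> \<open>The ideal has no terms below degree \<open>k\<close>, so a form of degree
    \<open>k - 1\<close> in it is zero.\<close>
  then have "Poly_Mapping.lookup F c = 0" if "monom_degree c < k" for c
    using that by (rule ideal_span_low(1)[OF assms(1)])
  then have "F = 0" using forms_lookup[OF F(1)] assms(2)
    by (intro poly_mapping_eqI) (metis diff_less less_one lookup_zero)
  then show False using \<open>F \<noteq> 0\<close> by blast
qed

section \<open>Failure of the weak Lefschetz property\<close>

context space_curve
begin

lemma not_max_rank:
  assumes k: "k > 0" "k \<ge> d" and P: "P \<noteq> 0"
    and Z: "Z \<subseteq> C" "card Z > d * k" "\<And>p. p \<in> Z \<Longrightarrow> is_dual_form (L p) p"
  shows "\<not> mult_max_rank (ideal.span ((\<lambda>p. L p ^ k) ` Z)) (k - 1) (linear_form P)"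
proof -
  let ?G = "(\<lambda>p. L p ^ k) ` Z"
  have "\<forall>p\<in>Z. \<exists>v. v \<in> p \<and> v \<noteq> 0 \<and> L p = linear_form v"
    using Z(3) by (auto simp: is_dual_form_def)
  then obtain w where w: "\<And>p. p \<in> Z \<Longrightarrow> w p \<in> p" "\<And>p. p \<in> Z \<Longrightarrow> w p \<noteq> 0"
    "\<And>p. p \<in> Z \<Longrightarrow> L p = linear_form (w p)" by metis
  have G: "?G \<subseteq> forms k" using w(3) by (auto simp: linear_form_power_forms)
  have fin: "finite Z" using Z(2) by (intro card_ge_0_finite) simp
  have apolar_pairing_G: "apolar_pairing (L p ^ k) \<Phi> = fact k * eval4 \<Phi> (w p)" if "\<Phi> \<in> forms k" "p \<in> Z" for \<Phi> p
    using apolar_pairing_linear_form_power[OF that(1)] w(3)[OF that(2)] by simp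
  \<comment> \<open>Orthogonality to the powers means vanishing on \<open>Z\<close>, and more than
    \<open>d * k\<close> zeros on \<open>C\<close> force membership in the ideal of
    \<open>C\<close>.\<close>
  have in_I: "\<Phi> \<in> I" if \<Phi>: "\<Phi> \<in> forms k" "\<And>g. g \<in> ?G \<Longrightarrow> apolar_pairing g \<Phi> = 0" for \<Phi>
  proof (rule bezout[OF \<Phi>(1) Z(1) fin Z(2)])
    fix p assume p: "p \<in> Z"
    have "eval4 \<Phi> (w p) = 0" using apolar_pairing_G[OF \<Phi>(1) p] \<Phi>(2)[of "L p ^ k"] p by simp
    moreover obtain v where "p = vec.span {v}" using p Z(1) curve_point by blast
    then have "p = vec.span {w p}" using span_single_eq w p by metis
    ultimately show "vanishes_at \<Phi> p" using vanishes_at_span_iff[OF \<Phi>(1) w(2)[OF p]] by simp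
  qed
  obtain a b F where f: "frame a b" "b 3 = P" and F: "F \<in> curve_frame.Q C a" "F \<noteq> 0"
    "\<And>G. G \<in> curve_frame.Q C a \<Longrightarrow> G \<noteq> 0 \<Longrightarrow> degree F \<le> degree G"
    "degree (lead_coeff F) = 0" "tdeg_le (degree F) F" "degree F \<le> d"
    by (rule exists_plane_curve[OF P]) (rule that; assumption)
  interpret f: frame a b by (rule f(1))
  interpret cf: curve_frame C d a b by unfold_locales
  have not_surj: "quotient_mult (ideal.span ?G) (linear_form P) ` quotient_piece (ideal.span ?G) (k - 1)
      \<noteq> quotient_piece (ideal.span ?G) k"
  proof (rule not_surjective[OF G k(1) homogenize_forms])
    \<comment> \<open>Homogenizing \<open>F\<close> in degree \<open>k\<close>, possible since
      \<open>degree F \<le> d \<le> k\<close>, gives a cone through \<open>C\<close> with vertex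
      \<open>P\<close>.\<close>
    let ?\<Phi> = "homogenize a k F"
    have tF: "tdeg_le k F" using F(5,6) k(2) tdeg_le_mono by (meson order_trans)
    obtain s x where "eval2 F s x \<noteq> 0" using F(2) by (rule exists_eval2_nonzero)
    then show "?\<Phi> \<noteq> 0" using f.homogenize_nonzero[OF tF] by (metis eval4_0)
    show "ddiff P ?\<Phi> = 0"
      unfolding ddiff_eq_0_iff using f.homogenize_translation_invariant f(2) by metis
    have "?\<Phi> \<in> I" using cf.homogenize_in_ideal_iff[OF tF] F(1) by blast
    then have "eval4 ?\<Phi> (w p) = 0" if "p \<in> Z" for p
      using vanishing_idealD[of ?\<Phi> C "w p"] w(1)[OF that] Z(1) that by blast
    then show "apolar_pairing g ?\<Phi> = 0" if "g \<in> ?G" for g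
      using that apolar_pairing_G[OF homogenize_forms] by auto
  qed
  \<comment> \<open>At least one of the powers \<open>l 0 ^ (k - 1)\<close> and
    \<open>l 1 ^ (k - 1)\<close> is missed. They are written as derivatives of
    \<open>l 3 * l i ^ (k - 1)\<close>, so that subtracting a preimage leaves a form with derivative
    zero, that is, a cone.\<close>
  have "\<exists>i\<in>{0, 1}. \<forall>\<Phi>. \<Phi> \<in> forms k \<and> (\<forall>g\<in>?G. apolar_pairing g \<Phi> = 0) \<longrightarrow>
      ddiff P \<Phi> \<noteq> ddiff P (linear_form (a 3) * linear_form (a i) ^ (k - 1))"
  proof (rule ccontr)
    assume "\<not> ?thesis"
    then have "\<forall>i\<in>{0, 1}. \<exists>\<Phi>. \<Phi> \<in> forms k \<and> (\<forall>g\<in>?G. apolar_pairing g \<Phi> = 0) \<and>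
      ddiff P \<Phi> = ddiff P (linear_form (a 3) * linear_form (a i) ^ (k - 1))" by blast
    then obtain \<Phi> where "\<forall>i\<in>{0, 1}. \<Phi> i \<in> forms k \<and> (\<forall>g\<in>?G. apolar_pairing g (\<Phi> i) = 0) \<and>
      ddiff P (\<Phi> i) = ddiff P (linear_form (a 3) * linear_form (a i) ^ (k - 1))"
      by (rule bchoice[THEN exE])
    then have \<Phi>: "\<Phi> i \<in> forms k" "\<And>g. g \<in> ?G \<Longrightarrow> apolar_pairing g (\<Phi> i) = 0"
      "ddiff P (linear_form (a 3) * linear_form (a i) ^ (k - 1) - \<Phi> i) = 0" if "i = 0 \<or> i = 1" for i
      using that by (auto simp: ddiff_diff)
    show False
    proof (rule not_both_powers_in_image[OF f(1) F(1-5) k(1), of \<Phi>])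
      fix i :: 4 assume i: "i = 0 \<or> i = 1"
      show "\<Phi> i \<in> forms k" "\<Phi> i \<in> I" using \<Phi>(1,2)[OF i] in_I by blast+
      show "eval4 (linear_form (a 3) * linear_form (a i) ^ (k - 1) - \<Phi> i) (v + c *s b 3) =
          eval4 (linear_form (a 3) * linear_form (a i) ^ (k - 1) - \<Phi> i) v" for v c
        using \<Phi>(3)[OF i] unfolding ddiff_eq_0_iff f(2) by blast
    qed
  qed
  then obtain i where "\<And>\<Phi>. \<Phi> \<in> forms k \<Longrightarrow> (\<And>g. g \<in> ?G \<Longrightarrow> apolar_pairing g \<Phi> = 0) \<Longrightarrow>
      ddiff P \<Phi> \<noteq> ddiff P (linear_form (a 3) * linear_form (a i) ^ (k - 1))" by blast
  moreover have "ddiff P (linear_form (a 3) * linear_form (a i) ^ (k - 1)) \<in> forms (k - 1)" for i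
    using forms_mult[OF linear_form_forms linear_form_power_forms, of "a 3" "a i" "k - 1"] k(1)
    by (intro ddiff_forms) simp
  ultimately have "\<not> inj_on (quotient_mult (ideal.span ?G) (linear_form P))
      (quotient_piece (ideal.span ?G) (k - 1))"
    using not_injective[OF G k(1)] by blast
  with not_surj show ?thesis using k(1) by (simp add: mult_max_rank_def)
qed

text \<open>Every nonempty open set of coefficient vectors contains a nonzero one, and maximal rank
  fails there.\<close>

lemma not_WLP:
  assumes "k > 0" "k \<ge> d" "Z \<subseteq> C" "card Z > d * k" "\<And>p. p \<in> Z \<Longrightarrow> is_dual_form (L p) p"
  shows "\<not> WLP_in_degree (ideal.span ((\<lambda>p. L p ^ k) ` Z)) (k - 1)"
proof
  assume "WLP_in_degree (ideal.span ((\<lambda>p. L p ^ k) ` Z)) (k - 1)"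
  then obtain G :: "'k poly4" where G: "G \<noteq> 0" "\<And>v. eval4 G v \<noteq> 0 \<Longrightarrow>
      mult_max_rank (ideal.span ((\<lambda>p. L p ^ k) ` Z)) (k - 1) (linear_form v)"
    by (auto simp: WLP_in_degree_def for_general_linear_form_def)
  obtain v where "v \<noteq> 0" "eval4 G v \<noteq> 0" by (rule exists_eval4_nonzero[OF G(1)])
  then show False using not_max_rank[OF assms(1,2) _ assms(3-5)] G(2) by blast
qed

text \<open>A new vector is chosen off one hyperplane through each set of at most three earlier
  ones; finitely many hyperplanes cannot cover \<open>C\<close>, as a product of nonzero linear
  forms stays outside the prime ideal.\<close>

lemma exists_general_position:
  "\<exists>V. V \<subseteq> \<Union>C \<and> finite V \<and> card V = n \<and>
    (\<forall>T\<subseteq>V. card T \<le> 4 \<longrightarrow> vec.independent T)"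
proof (induction n)
  case 0
  show ?case by (rule exI[of _ "{}"]) (auto simp: vec.dependent_def)
next
  case (Suc n)
  then obtain V where V: "V \<subseteq> \<Union>C" "finite V" "card V = n"
    "\<And>T. T \<subseteq> V \<Longrightarrow> card T \<le> 4 \<Longrightarrow> vec.independent T" by blast
  \<comment> \<open>Sets with fewer than three elements are included, so the new vector is nonzero
    and not parallel to an old one.\<close>
  define A where "A = {T. T \<subseteq> V \<and> card T \<le> 3}"
  have "finite A" using V(2) by (simp add: A_def)
  have "\<exists>c. c \<noteq> 0 \<and> (\<forall>u\<in>vec.span T. dot c u = 0)" if T: "T \<in> A" for T
  proof -
    have "finite T" using T V(2) finite_subset by (auto simp: A_def)
    then have "vec.dim (vec.span T) \<le> 3"
      using vec.dim_le_card[of "vec.span T" T] T by (auto simp: A_def)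
    moreover have "vec.dim (UNIV :: ('k ^ 4) set) = 4" by (simp add: vec.dim_UNIV card_cart_basis)
    ultimately have "vec.span T \<noteq> UNIV" by (intro notI) simp
    then obtain v where v: "v \<notin> vec.span T" by blast
    obtain c where c: "\<And>u. u \<in> vec.span T \<Longrightarrow> dot c u = 0" "dot c v = 1"
      using separating_covector[of v "vec.span T"] v by (metis vec.span_span)
    then have "c \<noteq> 0" by auto
    with c(1) show ?thesis by blast
  qed
  then obtain c where c: "\<And>T. T \<in> A \<Longrightarrow> c T \<noteq> 0" "\<And>T u. T \<in> A \<Longrightarrow> u \<in> vec.span T \<Longrightarrow> dot (c T) u = 0"
    by metis
  have "(\<Prod>T\<in>A. linear_form (c T)) \<notin> I"
    using prod_linear_forms_notin_ideal[OF \<open>finite A\<close> c(1)] .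
  then obtain v where v: "v \<in> \<Union>C" "(\<Prod>T\<in>A. dot (c T) v) \<noteq> 0"
    unfolding mem_vanishing_ideal_iff by auto
  then have notin: "v \<notin> vec.span T" if "T \<in> A" for T
    using c(2)[OF that] that \<open>finite A\<close> by (metis prod_zero)
  have "{} \<in> A" by (simp add: A_def)
  have vV: "v \<notin> V"
  proof
    assume "v \<in> V"
    then have "{v} \<in> A" by (simp add: A_def)
    then show False using notin vec.span_base by blast
  qed
  have "vec.independent T" if T: "T \<subseteq> insert v V" "card T \<le> 4" for T
  proof (cases "v \<in> T")
    case False
    then show ?thesis using V(4) T by blast
  next
    case True
    have "finite T" using T(1) V(2) finite_subset by blast
    have "card (T - {v}) \<le> 3" using True T(2) \<open>finite T\<close> by simp
    then have "T - {v} \<in> A" using T(1) by (auto simp: A_def)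
    moreover have "vec.independent (T - {v})" using \<open>card (T - {v}) \<le> 3\<close> T(1) by (intro V(4)) auto
    ultimately have "vec.independent (insert v (T - {v}))"
      using notin by (intro vec.independent_insertI) auto
    then show ?thesis using True by (simp add: insert_absorb)
  qed
  then show ?case using V v(1) vV by (intro exI[of _ "insert v V"]) auto
qed

text \<open>Four forms vanish at a common point only if their coefficient vectors lie in a
  hyperplane, which independence rules out.\<close>

lemma exists_dual_forms_general_position:
  obtains Z L where "Z \<subseteq> C" "card Z = n" "\<And>p. p \<in> Z \<Longrightarrow> is_dual_form (L p) p"
    "\<And>S. S \<subseteq> Z \<Longrightarrow> card S = 4 \<Longrightarrow> \<not> (\<exists>q\<in>proj_space. \<forall>p\<in>S. vanishes_at (L p) q)"
proof -
  obtain V where V: "V \<subseteq> \<Union>C" "finite V" "card V = n"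
    "\<And>T. T \<subseteq> V \<Longrightarrow> card T \<le> 4 \<Longrightarrow> vec.independent T"
    using exists_general_position[of n] by blast
  have V0: "v \<noteq> 0" if "v \<in> V" for v using V(4)[of "{v}"] that by auto
  define pt where "pt = (\<lambda>v :: 'k ^ 4. vec.span {v})"
  have inj: "inj_on pt V"
  proof (rule inj_onI, rule ccontr)
    fix u v assume uv: "u \<in> V" "v \<in> V" "pt u = pt v" "u \<noteq> v"
    \<comment> \<open>Independence of pairs keeps the points of distinct vectors distinct, so that
      \<open>Z\<close> has exactly \<open>n\<close> elements.\<close>
    have "vec.independent {u, v}" using uv card_insert_le_m1[of 4 "{v}" u] by (intro V(4)) auto
    moreover have "u \<in> vec.span {v}" using uv(3) vec.span_base[of u "{u}"] by (simp add: pt_def)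
    moreover have "{u, v} - {u} = {v}" using uv(4) by auto
    ultimately show False by (auto simp: vec.dependent_def)
  qed
  define Z where "Z = pt ` V"
  define r where "r = inv_into V pt"
  define L where "L = (\<lambda>p. linear_form (r p))"
  have r: "r p \<in> V" "pt (r p) = p" if "p \<in> Z" for p
    using inv_into_into[of p pt V] f_inv_into_f[of p pt V] that by (simp_all add: r_def Z_def)
  show thesis
  proof (rule that[of Z L])
    show "Z \<subseteq> C"
    proof
      fix p assume p: "p \<in> Z"
      then obtain X where X: "X \<in> C" "r p \<in> X" using r(1) V(1) by blast
      obtain u where "X = vec.span {u}" using X(1) by (rule curve_point)
      then have "vec.span {r p} = X" using span_single_eq X(2) V0[OF r(1)[OF p]] by blast
      then show "p \<in> C" using r(2)[OF p] X(1) by (simp add: pt_def)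
    qed
    show "card Z = n" using card_image[OF inj] V(3) by (simp add: Z_def)
    show "is_dual_form (L p) p" if "p \<in> Z" for p
      using V0[OF r(1)[OF that]] r(2)[OF that] vec.span_base[of "r p" "{r p}"]
      unfolding is_dual_form_def L_def pt_def by blast
    fix S assume S: "S \<subseteq> Z" "card S = 4"
    show "\<not> (\<exists>q\<in>proj_space. \<forall>p\<in>S. vanishes_at (L p) q)"
    proof
      assume "\<exists>q\<in>proj_space. \<forall>p\<in>S. vanishes_at (L p) q"
      then obtain v where v: "v \<noteq> 0" "\<And>p. p \<in> S \<Longrightarrow> vanishes_at (L p) (vec.span {v})"
        by (auto simp: proj_space_def)
      have zero: "dot v (r p) = 0" if "p \<in> S" for p
        using v(2)[OF that] vanishes_at_span_iff[OF linear_form_forms v(1)]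
        by (simp add: L_def dot_commute[of v])
      have "inj_on r S" using r(2) S(1) by (intro inj_onI) (metis subsetD)
      then have card: "card (r ` S) = 4" using S(2) by (simp add: card_image)
      have "vec.independent (r ` S)" using card r(1) S(1) by (intro V(4)) auto
      moreover have "vec.dim (UNIV :: ('k ^ 4) set) = 4" by (simp add: vec.dim_UNIV card_cart_basis)
      ultimately have span: "UNIV \<subseteq> vec.span (r ` S)"
        using card by (intro vec.card_ge_dim_independent) auto
      have "vec.span (r ` S) \<subseteq> {u. dot v u = 0}"
        using zero by (intro vec.span_minimal) (auto simp: vec.subspace_def)
      then have "dot v u = 0" for u using span by blast
      moreover obtain u where "dot u v = 1" using exists_covector_nonzero[OF v(1)] by blast
      ultimately show False by (metis dot_commute zero_neq_one)
    qed
  qed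
qed

end

theorem corollary2p18:
  fixes C :: "('k::{alg_closed_field, field_char_0} ^ 4) set set"
    and d k m :: nat
  assumes "irreducible_curve C"
    and "nondegenerate C"
    and "has_degree C d"
    and "d \<ge> 3"
    and "k \<ge> d"
    and "m \<ge> d * k + 1"
  shows "(\<forall>Z L. Z \<subseteq> C \<and> card Z = m \<and> (\<forall>p\<in>Z. is_dual_form (L p) p) \<longrightarrow>
            \<not> WLP_in_degree (ideal.span ((\<lambda>p. L p ^ k) ` Z)) (k - 1))
       \<and> (\<exists>Z L. Z \<subseteq> C \<and> card Z = m \<and> (\<forall>p\<in>Z. is_dual_form (L p) p) \<and>
            (\<forall>S \<subseteq> Z. card S = 4 \<longrightarrow> \<not> (\<exists>q\<in>proj_space. \<forall>p\<in>S. vanishes_at (L p) q)) \<and>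
            \<not> WLP_in_degree (ideal.span ((\<lambda>p. L p ^ k) ` Z)) (k - 1))"
proof -
  interpret space_curve C d by unfold_locales (fact assms)+
  \<comment> \<open>Here \<open>k\<close> is positive because \<open>k \<ge> d \<ge> 3\<close>, and
    \<open>m \<ge> d * k + 1\<close> is the number of points that Bezout's theorem asks for.\<close>
  have fails: "\<not> WLP_in_degree (ideal.span ((\<lambda>p. L p ^ k) ` Z)) (k - 1)"
    if "Z \<subseteq> C" "card Z = m" "\<forall>p\<in>Z. is_dual_form (L p) p" for Z L
    using assms that by (intro not_WLP) auto
  obtain Z L where "Z \<subseteq> C" "card Z = m" "\<And>p. p \<in> Z \<Longrightarrow> is_dual_form (L p) p"
    "\<And>S. S \<subseteq> Z \<Longrightarrow> card S = 4 \<Longrightarrow> \<not> (\<exists>q\<in>proj_space. \<forall>p\<in>S. vanishes_at (L p) q)"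
    by (rule exists_dual_forms_general_position[of m]) (rule that; assumption)
  then show ?thesis using fails by (intro conjI) blast+
qed

end
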